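(* Let $c$ be the all-different constraint on $n$ variables $v_1,\dots,v_n$ with domain $[1,d]$. Unit-propagation on the program consisting, for each $v\in\{v_1,\dots,v_n\}$, of the rules $$\{e(v,1),\dots,e(v,d)\}\leftarrow,\qquad \bot\leftarrow \mathit{not}\,e(v,1),\dots,\mathit{not}\,e(v,d),\qquad \bot\leftarrow 2\,\{e(v,1),\dots,e(v,d)\},$$ and, for each $i\in[1,d]$, of the rule $$violate(c)\leftarrow 2\,\{e(v_1,i),\dots,e(v_n,i)\},$$ with $c$ required to hold, enforces arc consistency on the binary decomposition $\{v_i\neq v_j : i<j\}$ of $c$, in $\mathcal{O}(nd^2)$ total time down any branch of the search tree.
   Context: Constraints. Variables have domain $[1,d]=\{1,\dots,d\}$. The all-different constraint on $v_1,\dots,v_n$ requires these variables to take pairwise different values. Given current domains $D(v)\subseteq[1,d]$, a binary constraint on $v,v'$ is arc consistent iff for each $a\in D(v)$ there is a compatible $b\in D(v')$, and vice versa. Enforcing arc consistency means replacing the domains by the largest subdomains for which all binary constraints considered are arc consistent; failure means that some domain becomes empty. Logic programs and unit-propagation. A rule $h\leftarrow a_1,\dots,a_m,\mathit{not}\,a_{m+1},\dots,\mathit{not}\,a_k$ has head $h$ and body the set of literals on its right; $\bot$ is the always-false atom. A choice rule $\{h_1,\dots,h_k\}\leftarrow$ leaves $h_1,\dots,h_k$ free. A cardinality body $k\{\ell_1,\dots,\ell_m\}$ holds iff at least $k$ of the literals $\ell_j$ hold. Unit-propagation works on partial truth assignments to atoms and rule bodies, using the nogoods (forbidden sets of truth-value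 assignments) expressing that: a body is true iff its literals are all true (for a cardinality body: iff at least $k$ of its literals are true; semantically one nogood per relevant subset of literals, but an implementation may realise the same inferences by other means such as counters); a true body makes its head true; an atom is true only if the body of some rule having it in its head is true; $\bot$ is false. Whenever all but one element of a nogood hold, the complement of the remaining element is added; a conflict occurs if all elements of some nogood hold. The atoms $e(v,i)$ mean $v=i$. The program also contains the reification rules $sat(c)\leftarrow\mathit{not}\,violate(c)$ and $violate(c)\leftarrow\mathit{not}\,sat(c)$. Enforcing a consistency by unit-propagation. Given nonempty initial domains $D(v)\subseteq[1,d]$, start from the assignment in which $violate(c)$ is false and $e(v,i)$ is false for all $i\notin D(v)$, and run unit-propagation to fixpoint. That unit-propagation enforces arc consistency means: for all such initial domains, a conflict occurs iff enforcing arc consistency fails, and otherwise, for every $v$, the set of $i$ with $e(v,i)$ not false at the fixpoint equals the domain of $v$ obtained by enforcing arc consistency. Search tree branch. A branch is a sequence of decisions, each assigning a truth value to an unassigned atom, with unit-propagation run to fixpoint after each decision, until a conflict occurs or everything is assigned. "In $\mathcal{O}(f)$ down any branch" means that unit-propagation can be implemented so that its total running time over any whole branch is $\mathcal{O}(f)$. *)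

theory Defs
  imports Main
begin

section \<open>Arc consistency\<close>

text \<open>
  A variable is a natural number and \<open>D v\<close> is the current domain of \<open>v\<close>.  A binary constraint
  \<open>(v, w, R)\<close> allows exactly the pairs \<open>(a, b)\<close> of values of \<open>v\<close> and \<open>w\<close> with \<open>R a b\<close>.
\<close>

type_synonym domains = "nat \<Rightarrow> nat set"
type_synonym constr = "nat \<times> nat \<times> (nat \<Rightarrow> nat \<Rightarrow> bool)"

definition arc_consistent :: "constr set \<Rightarrow> domains \<Rightarrow> bool" where
  "arc_consistent C D \<longleftrightarrow> (\<forall>(v, w, R) \<in> C.
     (\<forall>a \<in> D v. \<exists>b \<in> D w. R a b) \<and> (\<forall>b \<in> D w. \<exists>a \<in> D v. R a b))"

text \<open>
  The order on \<^typ>\<open>domains\<close> is pointwise inclusion.  The greatest element always exists, because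
  pointwise unions of arc consistent domains are arc consistent.
\<close>

definition enforce_ac :: "constr set \<Rightarrow> domains \<Rightarrow> domains" where
  "enforce_ac C D = (GREATEST D'. D' \<le> D \<and> arc_consistent C D')"

definition neq_decomposition :: "nat \<Rightarrow> constr set" where
  "neq_decomposition n = {(i, j, (\<noteq>)) | i j. 1 \<le> i \<and> i < j \<and> j \<le> n}"

definition initial_domains :: "nat \<Rightarrow> nat \<Rightarrow> domains \<Rightarrow> bool" where
  "initial_domains n d D \<longleftrightarrow> (\<forall>v \<in> {1..n}. D v \<noteq> {} \<and> D v \<subseteq> {1..d})"


section \<open>Logic programs and their nogoods\<close>

text \<open>
  \<open>E v i\<close> stands for \<open>v = i\<close>; \<open>Sat\<close> and \<open>Violate\<close> are the reification atoms of the one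
  constraint under consideration; \<open>Bot\<close> is the atom that is always false.
\<close>

datatype atom = Bot | E nat nat | Sat | Violate
datatype literal = Pos atom | Neg atom
datatype body = Conj "literal set" | Card nat "literal set"
datatype rule = Rule atom body | Choice "atom set" body

fun body_of :: "rule \<Rightarrow> body" where
  "body_of (Rule h B) = B"
| "body_of (Choice H B) = B"

fun heads :: "rule \<Rightarrow> atom set" where
  "heads (Rule h B) = {h}"
| "heads (Choice H B) = H"

fun lit_atom :: "literal \<Rightarrow> atom" where
  "lit_atom (Pos a) = a"
| "lit_atom (Neg a) = a"

fun body_atoms :: "body \<Rightarrow> atom set" where
  "body_atoms (Conj L) = lit_atom ` L"
| "body_atoms (Card k L) = lit_atom ` L"

definition atoms :: "rule list \<Rightarrow> atom set" where
  "atoms P = insert Bot (\<Union>r \<in> set P. heads r \<union> body_atoms (body_of r))"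

text \<open>Truth values are assigned to atoms and to bodies; rules with equal bodies share them.\<close>

datatype entity = Atom atom | Body body

type_synonym nogood = "(entity \<times> bool) set"
type_synonym assignment = "entity \<Rightarrow> bool option"

fun lit_true :: "literal \<Rightarrow> entity \<times> bool" where
  "lit_true (Pos a) = (Atom a, True)"
| "lit_true (Neg a) = (Atom a, False)"

fun lit_false :: "literal \<Rightarrow> entity \<times> bool" where
  "lit_false (Pos a) = (Atom a, False)"
| "lit_false (Neg a) = (Atom a, True)"

text \<open>
  At least \<open>k\<close> of the literals in \<open>L\<close> are true iff no \<open>card L + 1 - k\<close> of them are all false.
  For \<open>k > card L\<close> the truncated difference is \<open>0\<close>, and the body alone cannot be true.
\<close>

fun body_nogoods :: "body \<Rightarrow> nogood set" where
  "body_nogoods (Conj L) =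
     {insert (Body (Conj L), False) (lit_true ` L)} \<union>
     {{(Body (Conj L), True), lit_false l} | l. l \<in> L}"
| "body_nogoods (Card k L) =
     {insert (Body (Card k L), False) (lit_true ` S) | S. S \<subseteq> L \<and> card S = k} \<union>
     {insert (Body (Card k L), True) (lit_false ` S) | S. S \<subseteq> L \<and> card S = card L + 1 - k}"

definition nogoods :: "rule list \<Rightarrow> nogood set" where
  "nogoods P =
     (\<Union>r \<in> set P. body_nogoods (body_of r)) \<union>
     {{(Body B, True), (Atom h, False)} | h B. Rule h B \<in> set P} \<union>
     {insert (Atom a, True) {(Body (body_of r), False) | r. r \<in> set P \<and> a \<in> heads r}
        | a. a \<in> atoms P} \<union>
     {{(Atom Bot, True)}}"


section \<open>Unit-propagation\<close>

definition conflict :: "nogood set \<Rightarrow> assignment \<Rightarrow> bool" where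
  "conflict N A \<longleftrightarrow> (\<exists>\<delta> \<in> N. \<forall>(x, b) \<in> \<delta>. A x = Some b)"

inductive up_step :: "nogood set \<Rightarrow> assignment \<Rightarrow> assignment \<Rightarrow> bool" for N where
  "\<lbrakk>\<delta> \<in> N; (x, b) \<in> \<delta>; \<forall>(y, c) \<in> \<delta> - {(x, b)}. A y = Some c; A x = None\<rbrakk>
     \<Longrightarrow> up_step N A (A(x \<mapsto> \<not> b))"

text \<open>
  Propagation is nondeterministic, so this is a relation.  All fixpoints reachable from the same
  assignment agree on whether there is a conflict, and coincide if there is none.
\<close>

definition up_fixpoint :: "nogood set \<Rightarrow> assignment \<Rightarrow> assignment \<Rightarrow> bool" where
  "up_fixpoint N A A' \<longleftrightarrow> (up_step N)\<^sup>*\<^sup>* A A' \<and> (\<nexists>A''. up_step N A' A'')"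

definition initial_assignment :: "nat \<Rightarrow> nat \<Rightarrow> domains \<Rightarrow> assignment" where
  "initial_assignment n d D = (\<lambda>x.
     if x = Atom Violate \<or> (\<exists>v \<in> {1..n}. \<exists>i \<in> {1..d} - D v. x = Atom (E v i))
     then Some False else None)"

definition up_enforces_ac :: "nat \<Rightarrow> nat \<Rightarrow> rule list \<Rightarrow> constr set \<Rightarrow> bool" where
  "up_enforces_ac n d P C \<longleftrightarrow> (\<forall>D. initial_domains n d D \<longrightarrow>
     (\<exists>A. up_fixpoint (nogoods P) (initial_assignment n d D) A) \<and>
     (\<forall>A. up_fixpoint (nogoods P) (initial_assignment n d D) A \<longrightarrow>
        (conflict (nogoods P) A \<longleftrightarrow> (\<exists>v \<in> {1..n}. enforce_ac C D v = {})) \<and>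
        (\<not> conflict (nogoods P) A \<longrightarrow>
           (\<forall>v \<in> {1..n}. {i \<in> {1..d}. A (Atom (E v i)) \<noteq> Some False} = enforce_ac C D v))))"

text \<open>
  \<open>branch P A\<^sub>0 ds A\<close>: the decisions \<open>ds\<close>, taken in this order from the root assignment \<open>A\<^sub>0\<close>, form
  an initial part of a branch, and propagation after the last of them ends in \<open>A\<close>.  The complete
  branches are those that admit no further decision.
\<close>

inductive branch :: "rule list \<Rightarrow> assignment \<Rightarrow> (atom \<times> bool) list \<Rightarrow> assignment \<Rightarrow> bool"
  for P A\<^sub>0 where
  root: "up_fixpoint (nogoods P) A\<^sub>0 A \<Longrightarrow> branch P A\<^sub>0 [] A"
| decide: "\<lbrakk>branch P A\<^sub>0 ds A; \<not> conflict (nogoods P) A; a \<in> atoms P; A (Atom a) = None;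
     up_fixpoint (nogoods P) (A(Atom a \<mapsto> b)) A'\<rbrakk> \<Longrightarrow> branch P A\<^sub>0 (ds @ [(a, b)]) A'"


section \<open>The program for the all-different constraint\<close>

definition alldiff_program :: "nat \<Rightarrow> nat \<Rightarrow> rule list" where
  "alldiff_program n d =
     concat (map (\<lambda>v.
       [Choice (E v ` {1..d}) (Conj {}),
        Rule Bot (Conj ((\<lambda>i. Neg (E v i)) ` {1..d})),
        Rule Bot (Card 2 ((\<lambda>i. Pos (E v i)) ` {1..d}))]) [1..<n + 1]) @
     map (\<lambda>i. Rule Violate (Card 2 ((\<lambda>v. Pos (E v i)) ` {1..n}))) [1..<d + 1] @
     [Rule Sat (Conj {Neg Violate}), Rule Violate (Conj {Neg Sat})]"


section \<open>Implementations and their running time\<close>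

text \<open>
  Running time is measured on a random access machine with unit costs, programmed in a while
  language.  The store holds named unbounded arrays of natural numbers; a scalar is an array used
  at index \<open>0\<close> only.  The arithmetic operations are addition and truncated subtraction; there is
  no multiplication, which at unit cost would be unrealistically strong.  Each assignment and
  each test counts as one step: the expressions of a fixed program have bounded size, so charging
  for their evaluation would change running times by a constant factor only.
\<close>

type_synonym store = "string \<Rightarrow> nat \<Rightarrow> nat"

datatype aexp = Const nat | Get string aexp | Plus aexp aexp | Minus aexp aexp
datatype bexp = Less aexp aexp | Eq aexp aexp | BNot bexp | BAnd bexp bexp
datatype com = Skip | Put string aexp aexp | Seq com com | If bexp com com | While bexp com

fun aval :: "aexp \<Rightarrow> store \<Rightarrow> nat" where
  "aval (Const k) s = k"
| "aval (Get x a) s = s x (aval a s)"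
| "aval (Plus a b) s = aval a s + aval b s"
| "aval (Minus a b) s = aval a s - aval b s"

fun bval :: "bexp \<Rightarrow> store \<Rightarrow> bool" where
  "bval (Less a b) s \<longleftrightarrow> aval a s < aval b s"
| "bval (Eq a b) s \<longleftrightarrow> aval a s = aval b s"
| "bval (BNot b) s \<longleftrightarrow> \<not> bval b s"
| "bval (BAnd b c) s \<longleftrightarrow> bval b s \<and> bval c s"

definition put :: "store \<Rightarrow> string \<Rightarrow> nat \<Rightarrow> nat \<Rightarrow> store" where
  "put s x i k = s(x := (s x)(i := k))"

text \<open>\<open>exec c s t s'\<close>: command \<open>c\<close> started in \<open>s\<close> terminates in \<open>s'\<close> after \<open>t\<close> steps.\<close>

inductive exec :: "com \<Rightarrow> store \<Rightarrow> nat \<Rightarrow> store \<Rightarrow> bool" where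
  Skip: "exec Skip s 1 s"
| Put: "exec (Put x a b) s 1 (put s x (aval a s) (aval b s))"
| Seq: "\<lbrakk>exec c1 s1 t1 s2; exec c2 s2 t2 s3\<rbrakk> \<Longrightarrow> exec (Seq c1 c2) s1 (t1 + t2) s3"
| IfTrue: "\<lbrakk>bval b s; exec c1 s t s'\<rbrakk> \<Longrightarrow> exec (If b c1 c2) s (1 + t) s'"
| IfFalse: "\<lbrakk>\<not> bval b s; exec c2 s t s'\<rbrakk> \<Longrightarrow> exec (If b c1 c2) s (1 + t) s'"
| WhileFalse: "\<not> bval b s \<Longrightarrow> exec (While b c) s 1 s"
| WhileTrue: "\<lbrakk>bval b s1; exec c s1 t1 s2; exec (While b c) s2 t2 s3\<rbrakk>
     \<Longrightarrow> exec (While b c) s1 (1 + t1 + t2) s3"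

fun atom_index :: "nat \<Rightarrow> nat \<Rightarrow> atom \<Rightarrow> nat" where
  "atom_index n d (E v i) = (v - 1) * d + (i - 1)"
| "atom_index n d Bot = n * d"
| "atom_index n d Sat = n * d + 1"
| "atom_index n d Violate = n * d + 2"

definition input_store :: "nat \<Rightarrow> nat \<Rightarrow> domains \<Rightarrow> store" where
  "input_store n d D = (\<lambda>x k.
     if x = ''n'' \<and> k = 0 then n
     else if x = ''d'' \<and> k = 0 then d
     else if x = ''dom'' \<and>
       (\<exists>v \<in> {1..n}. \<exists>i \<in> D v \<inter> {1..d}. k = atom_index n d (E v i)) then 1
     else 0)"

definition write_decision :: "nat \<Rightarrow> nat \<Rightarrow> atom \<times> bool \<Rightarrow> store \<Rightarrow> store" where
  "write_decision n d dec s =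
     put (put s ''decision'' 0 (atom_index n d (fst dec))) ''decision'' 1 (if snd dec then 1 else 0)"

text \<open>
  An implementation consists of a command \<open>start\<close>, which reads the input and propagates at the
  root, and a command \<open>resume\<close>, which is called anew for each decision and keeps its data
  structures in the store between calls.  So it learns a decision only after it has finished
  propagating all earlier ones.  In \<open>session start resume n d D ds s t\<close>, \<open>s\<close> is the store after the
  decisions \<open>ds\<close> and \<open>t\<close> is the total number of steps since the beginning, initialisation included.
\<close>

inductive session ::
  "com \<Rightarrow> com \<Rightarrow> nat \<Rightarrow> nat \<Rightarrow> domains \<Rightarrow> (atom \<times> bool) list \<Rightarrow> store \<Rightarrow> nat \<Rightarrow> bool"
  for start resume n d D where
  start: "exec start (input_store n d D) t s \<Longrightarrow> session start resume n d D [] s t"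
| resume: "\<lbrakk>session start resume n d D ds s t;
     exec resume (write_decision n d dec s) t' s'\<rbrakk>
     \<Longrightarrow> session start resume n d D (ds @ [dec]) s' (t + t')"

fun encode :: "bool option \<Rightarrow> nat" where
  "encode None = 0"
| "encode (Some False) = 1"
| "encode (Some True) = 2"

text \<open>
  The store must tell whether there is a conflict and, if there is none, hold the complete
  assignment, with the value of a body stored under the position of each rule having that body.
\<close>

definition represents :: "nat \<Rightarrow> nat \<Rightarrow> rule list \<Rightarrow> store \<Rightarrow> assignment \<Rightarrow> bool" where
  "represents n d P s A \<longleftrightarrow>
     (s ''conflict'' 0 \<noteq> 0 \<longleftrightarrow> conflict (nogoods P) A) \<and>
     (\<not> conflict (nogoods P) A \<longrightarrow>
        (\<forall>a \<in> atoms P. s ''atom'' (atom_index n d a) = encode (A (Atom a))) \<and>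
        (\<forall>j < length P. s ''body'' j = encode (A (Body (body_of (P ! j))))))"

text \<open>
  The commands and the constant \<open>K\<close> are the same for all \<open>n\<close>, \<open>d\<close>, initial domains and branches.
\<close>

definition up_total_time :: "(nat \<Rightarrow> nat \<Rightarrow> rule list) \<Rightarrow> (nat \<Rightarrow> nat \<Rightarrow> nat) \<Rightarrow> bool" where
  "up_total_time P f \<longleftrightarrow> (\<exists>start resume K. \<forall>n \<ge> 1. \<forall>d \<ge> 1. \<forall>D ds A.
     initial_domains n d D \<longrightarrow>
     branch (P n d) (initial_assignment n d D) ds A \<longrightarrow>
     (\<exists>s t. session start resume n d D ds s t \<and> t \<le> K * f n d \<and> represents n d (P n d) s A))"

end

theory Submission
  imports Defs
begin

text \<open>
  Once \<open>Violate\<close> is false, a conflict-free fixpoint of unit-propagation fixes \<open>Bot\<close>, \<open>Sat\<close> and all bodies,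
  so it is determined by its values on the atoms \<open>E v i\<close>.  These form a grid that is closed under two
  rules: a true cell makes the rest of its row and column false, and a cell whose row is otherwise
  false is true.  Conversely every closed grid yields a conflict-free fixpoint, and fixpoints reached
  from below it stay below it.  So propagation computes the least closed grid above the start, or a
  conflict if there is none.  For grids of domains, closedness is arc consistency without
  empty domains.

  The implementation keeps for each row the number of cells not known to be false and the sum of
  their indices.  When the number drops to one, the sum is the index of the remaining cell, so no
  search is needed.  True cells enter a queue; processing one of them scans the whole grid in time
  \<open>O(nd)\<close>.  As long as there is no conflict, processed cells lie in distinct columns, so at most \<open>d\<close> of them are
  ever processed along a branch, and each of the at most \<open>nd\<close> decisions costs constant extra time.
\<close>

section \<open>Fixpoints of unit-propagation\<close>

text \<open>The specification speaks about every fixpoint of a nondeterministic relation, while the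
  program propagates in an order of its own. Instead of simulating derivations step by step, both
  are compared with a third object, the set of closed grids above the start. A fixpoint lies below
  each member of this set and, if free of conflict, is itself a member; the program maintains the
  corresponding facts as invariants of its array. Conflicts need no separate analysis of their
  origin: they only have to be matched with emptiness of the set.

  \<open>Violate\<close> being false is what makes columns propagate, since it forces every column
  body to be false, as \<open>Bot\<close> does for the row bodies. Equal bodies share one truth
  value, and for \<open>d = 0\<close> the at-least body of a row would be the empty choice body;
  hence the recurring premise \<open>n = 0 \<or> d \<ge> 1\<close>.

  Decisions arrive one at a time, so the time bound has to survive from call to call. This is
  achieved by a potential that pays in advance for all scans that may still occur.\<close>

definition stable :: "nogood set \<Rightarrow> assignment \<Rightarrow> bool" where
  "stable N A \<longleftrightarrow> (\<forall>\<delta>\<in>N. \<forall>x b. (x, b) \<in> \<delta> \<longrightarrow>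
     (\<forall>(y, c) \<in> \<delta> - {(x, b)}. A y = Some c) \<longrightarrow> A x = Some (\<not> b))"

lemma stableD:
  assumes "stable N A" "\<delta> \<in> N" "(x, b) \<in> \<delta>"
    and "\<And>y c. (y, c) \<in> \<delta> \<Longrightarrow> (y, c) \<noteq> (x, b) \<Longrightarrow> A y = Some c"
  shows "A x = Some (\<not> b)"
  using assms unfolding stable_def by blast

lemma stable_insertD:
  assumes "stable N A" "insert (x, b) \<gamma> \<in> N" "\<forall>(y, c) \<in> \<gamma>. A y = Some c"
  shows "A x = Some (\<not> b)"
  by (rule stableD[OF assms(1,2)]) (use assms(3) in auto)

text \<open>Absence of a step excludes \<open>None\<close> for the last element of a nogood, absence
  of a conflict excludes the forbidden value; only the complement remains.\<close>

lemma fixpoint_stable: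
  assumes "\<nexists>A'. up_step N A A'" "\<not> conflict N A"
  shows "stable N A"
  unfolding stable_def
proof (intro ballI allI impI)
  fix \<delta> x b
  assume \<delta>: "\<delta> \<in> N" "(x, b) \<in> \<delta>" and rest: "\<forall>(y, c) \<in> \<delta> - {(x, b)}. A y = Some c"
  have "A x \<noteq> None" using assms(1) up_step.intros[OF \<delta> rest] by blast
  moreover have "A x \<noteq> Some b"
  proof
    assume "A x = Some b"
    with rest have "\<forall>(y, c) \<in> \<delta>. A y = Some c" by blast
    with \<delta>(1) assms(2) show False unfolding conflict_def by blast
  qed
  ultimately show "A x = Some (\<not> b)" by (cases "A x") auto
qed

text \<open>The value written by a step is forced by the other elements of a nogood. They hold in
  \<open>M\<close> too, so stability forces the same value there. Hence a stable assignment bounds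
  all derivations that start below it, in whatever order they proceed.\<close>

lemma up_step_below_stable:
  assumes "up_step N A B" "stable N M" "A \<subseteq>\<^sub>m M"
  shows "B \<subseteq>\<^sub>m M"
  using assms(1)
proof cases
  case (1 \<delta> x b)
  have "M x = Some (\<not> b)"
  proof (rule stableD[OF assms(2) 1(2,3)])
    fix y c assume "(y, c) \<in> \<delta>" "(y, c) \<noteq> (x, b)"
    with 1(4) have "A y = Some c" by auto
    with assms(3) show "M y = Some c" by (auto simp: map_le_def dom_def)
  qed
  with assms(3) show ?thesis unfolding 1(1) by (auto simp: map_le_def)
qed

lemma up_steps_below_stable:
  assumes "(up_step N)\<^sup>*\<^sup>* A B" "stable N M" "A \<subseteq>\<^sub>m M"
  shows "B \<subseteq>\<^sub>m M"
  using assms by (induction) (auto intro: up_step_below_stable)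

text \<open>A nogood that holds in \<open>A\<close> would hold in \<open>M\<close> too, where
  stability complements each of its elements. An empty nogood would always be in conflict, hence the
  last premise.\<close>

lemma below_stable_no_conflict:
  assumes "stable N M" "A \<subseteq>\<^sub>m M" "{} \<notin> N"
  shows "\<not> conflict N A"
proof
  assume "conflict N A"
  then obtain \<delta> where \<delta>: "\<delta> \<in> N" "\<forall>(x, b) \<in> \<delta>. A x = Some b"
    unfolding conflict_def by blast
  with assms(3) obtain x b where xb: "(x, b) \<in> \<delta>" by (cases "\<delta> = {}") auto
  have M: "\<And>y c. (y, c) \<in> \<delta> \<Longrightarrow> M y = Some c"
    using \<delta>(2) assms(2) by (force simp: map_le_def dom_def)
  have "M x = Some (\<not> b)" by (rule stableD[OF assms(1) \<delta>(1) xb]) (rule M)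
  with M[OF xb] show False by simp
qed

lemma up_steps_map_le: "(up_step N)\<^sup>*\<^sup>* A B \<Longrightarrow> A \<subseteq>\<^sub>m B"
proof (induction rule: rtranclp_induct)
  case (step B C)
  from step(2) have "B \<subseteq>\<^sub>m C" by cases (auto simp: map_le_def)
  with step(3) show ?case by (rule map_le_trans)
qed simp

text \<open>Each step assigns an entity that occurs in some nogood, so the number of such entities
  without a value decreases.\<close>

lemma up_fixpoint_exists:
  assumes "finite (fst ` \<Union>N)"
  shows "\<exists>B. up_fixpoint N A B"
proof (induction "card {x \<in> fst ` \<Union>N. A x = None}" arbitrary: A rule: less_induct)
  case less
  show ?case
  proof (cases "\<exists>A'. up_step N A A'")
    case False
    then show ?thesis unfolding up_fixpoint_def by blast
  next
    case True
    then obtain A' where s: "up_step N A A'" ..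
    from s have "{x \<in> fst ` \<Union>N. A' x = None} \<subset> {x \<in> fst ` \<Union>N. A x = None}"
    proof cases
      case (1 \<delta> x b)
      have "x \<in> fst ` \<Union>N" using 1(2,3) by force
      with 1 show ?thesis by auto
    qed
    then have "card {x \<in> fst ` \<Union>N. A' x = None} < card {x \<in> fst ` \<Union>N. A x = None}"
      using assms by (intro psubset_card_mono) auto
    from less[OF this] obtain B where "up_fixpoint N A' B" ..
    with s show ?thesis unfolding up_fixpoint_def by (meson converse_rtranclp_into_rtranclp)
  qed
qed

section \<open>Unit-propagation for the all-different program\<close>

text \<open>The last conjunct, read at any cell of an entirely false row, demands that this cell be
  true. So for \<open>d \<ge> 1\<close> no closed grid has such a row, and a domain wipe-out shows
  up as the nonexistence of a closed grid.\<close>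

definition closed :: "nat \<Rightarrow> nat \<Rightarrow> (nat \<Rightarrow> nat \<Rightarrow> bool option) \<Rightarrow> bool" where
  "closed n d S \<longleftrightarrow> (\<forall>v\<in>{1..n}. \<forall>i\<in>{1..d}.
     (S v i = Some True \<longrightarrow> (\<forall>j\<in>{1..d}. j \<noteq> i \<longrightarrow> S v j = Some False) \<and>
                            (\<forall>w\<in>{1..n}. w \<noteq> v \<longrightarrow> S w i = Some False)) \<and>
     ((\<forall>j\<in>{1..d}. j \<noteq> i \<longrightarrow> S v j = Some False) \<longrightarrow> S v i = Some True))"

lemma closedD_row:
  "closed n d S \<Longrightarrow> v \<in> {1..n} \<Longrightarrow> i \<in> {1..d} \<Longrightarrow> j \<in> {1..d} \<Longrightarrow> j \<noteq> i \<Longrightarrow> S v i = Some True \<Longrightarrow>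
     S v j = Some False"
  unfolding closed_def by blast

lemma closedD_col:
  "closed n d S \<Longrightarrow> v \<in> {1..n} \<Longrightarrow> i \<in> {1..d} \<Longrightarrow> w \<in> {1..n} \<Longrightarrow> w \<noteq> v \<Longrightarrow> S v i = Some True \<Longrightarrow>
     S w i = Some False"
  unfolding closed_def by blast

text \<open>The only true bodies are the empty body of the choice rules and the body that supports
  \<open>Sat\<close>: the other rules have heads \<open>Bot\<close> and \<open>Violate\<close>,
  which are false. The value is a function of the body rather than of the rule, because equal bodies
  are one entity; for \<open>n = d = 1\<close> the cardinality bodies of row and column
  coincide.\<close>

definition completion :: "nat \<Rightarrow> nat \<Rightarrow> (nat \<Rightarrow> nat \<Rightarrow> bool option) \<Rightarrow> assignment" where
  "completion n d S x = (case x of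
     Atom Bot \<Rightarrow> Some False
   | Atom Sat \<Rightarrow> Some True
   | Atom Violate \<Rightarrow> Some False
   | Atom (E v i) \<Rightarrow> if v \<in> {1..n} \<and> i \<in> {1..d} then S v i else None
   | Body B \<Rightarrow> if B \<in> body_of ` set (alldiff_program n d)
       then Some (B = Conj {} \<or> B = Conj {Neg Violate}) else None)"

lemma completion_simps [simp]:
  "completion n d S (Atom Bot) = Some False"
  "completion n d S (Atom Sat) = Some True"
  "completion n d S (Atom Violate) = Some False"
  "v \<in> {1..n} \<Longrightarrow> i \<in> {1..d} \<Longrightarrow> completion n d S (Atom (E v i)) = S v i"
  by (auto simp: completion_def)

section \<open>Rules, atoms and nogoods of the program\<close>

lemma set_alldiff_program:
  "set (alldiff_program n d) =
     (\<Union>v\<in>{1..n}. {Choice (E v ` {1..d}) (Conj {}),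
        Rule Bot (Conj ((\<lambda>i. Neg (E v i)) ` {1..d})),
        Rule Bot (Card 2 ((\<lambda>i. Pos (E v i)) ` {1..d}))}) \<union>
     (\<Union>i\<in>{1..d}. {Rule Violate (Card 2 ((\<lambda>v. Pos (E v i)) ` {1..n}))}) \<union>
     {Rule Sat (Conj {Neg Violate}), Rule Violate (Conj {Neg Sat})}"
  unfolding alldiff_program_def
  by (simp add: atLeastLessThanSuc_atLeastAtMost UNION_singleton_eq_range Un_assoc del: upt_Suc)

lemma alldiff_rule_cases [consumes 1, case_names choice atleast atmost column sat violate]:
  assumes "r \<in> set (alldiff_program n d)"
  obtains v where "v \<in> {1..n}" "r = Choice (E v ` {1..d}) (Conj {})"
  | v where "v \<in> {1..n}" "r = Rule Bot (Conj ((\<lambda>i. Neg (E v i)) ` {1..d}))"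
  | v where "v \<in> {1..n}" "r = Rule Bot (Card 2 ((\<lambda>i. Pos (E v i)) ` {1..d}))"
  | i where "i \<in> {1..d}" "r = Rule Violate (Card 2 ((\<lambda>v. Pos (E v i)) ` {1..n}))"
  | "r = Rule Sat (Conj {Neg Violate})"
  | "r = Rule Violate (Conj {Neg Sat})"
  using assms unfolding set_alldiff_program by auto

lemma atoms_alldiff_program:
  assumes "a \<in> atoms (alldiff_program n d)"
  obtains "a = Bot" | "a = Sat" | "a = Violate"
  | v i where "v \<in> {1..n}" "i \<in> {1..d}" "a = E v i"
proof -
  consider "a = Bot" | r where "r \<in> set (alldiff_program n d)" "a \<in> heads r \<union> body_atoms (body_of r)"
    using assms unfolding atoms_def by blast
  then show ?thesis
  proof cases
    case 2
    from 2 show ?thesis by (cases rule: alldiff_rule_cases) (auto intro: that)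
  qed (rule that)
qed

lemma body_nogoods_nonempty: "{} \<notin> body_nogoods B"
  by (cases B) auto

lemma nogoods_nonempty: "{} \<notin> nogoods P"
  unfolding nogoods_def using body_nogoods_nonempty by fastforce

lemma fst_lit [simp]:
  "fst (lit_true l) = Atom (lit_atom l)" "fst (lit_false l) = Atom (lit_atom l)"
  by (cases l; simp)+

lemma body_nogoods_entities:
  assumes "\<delta> \<in> body_nogoods B" "p \<in> \<delta>"
  shows "fst p \<in> insert (Body B) (Atom ` body_atoms B)"
proof (cases B)
  case (Conj L)
  with assms show ?thesis by auto
next
  case (Card k L)
  with assms show ?thesis by (auto simp: image_iff)
qed

lemma nogood_body: "r \<in> set P \<Longrightarrow> \<delta> \<in> body_nogoods (body_of r) \<Longrightarrow> \<delta> \<in> nogoods P"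
  unfolding nogoods_def by blast

lemma nogood_head: "Rule h B \<in> set P \<Longrightarrow> {(Body B, True), (Atom h, False)} \<in> nogoods P"
  unfolding nogoods_def by blast

lemma nogood_Bot: "{(Atom Bot, True)} \<in> nogoods P"
  unfolding nogoods_def by blast

lemma nogoods_cases [consumes 1, case_names body head support Bot]:
  assumes "\<delta> \<in> nogoods P"
  obtains r where "r \<in> set P" "\<delta> \<in> body_nogoods (body_of r)"
  | h B where "Rule h B \<in> set P" "\<delta> = {(Body B, True), (Atom h, False)}"
  | a where "a \<in> atoms P" "\<delta> = insert (Atom a, True) {(Body (body_of r), False) | r. r \<in> set P \<and> a \<in> heads r}"
  | "\<delta> = {(Atom Bot, True)}"
  using assms unfolding nogoods_def by blast


lemma finite_nogood_entities:
  assumes "\<And>r. r \<in> set P \<Longrightarrow> finite (heads r) \<and> finite (body_atoms (body_of r))"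
  shows "finite (fst ` \<Union>(nogoods P))"
proof (rule finite_subset)
  show "fst ` \<Union>(nogoods P) \<subseteq> Atom ` atoms P \<union> (\<lambda>r. Body (body_of r)) ` set P"
  proof clarsimp
    fix x b \<delta> assume \<delta>: "\<delta> \<in> nogoods P" and x: "(x, b) \<in> \<delta>" "x \<notin> (\<lambda>r. Body (body_of r)) ` set P"
    from \<delta> show "x \<in> Atom ` atoms P"
    proof (cases rule: nogoods_cases)
      case (body r)
      with body_nogoods_entities[OF body(2) x(1)] x(2) show ?thesis
        by (auto simp: atoms_def)
    next
      case (head h B)
      then have "Body B \<in> (\<lambda>r. Body (body_of r)) ` set P" "h \<in> atoms P"
        by (force simp: atoms_def)+
      with head x show ?thesis by auto
    qed (use x in \<open>auto simp: atoms_def\<close>)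
  qed
  show "finite (Atom ` atoms P \<union> (\<lambda>r. Body (body_of r)) ` set P)"
    using assms by (auto simp: atoms_def)
qed

lemma finite_alldiff_nogood_entities: "finite (fst ` \<Union>(nogoods (alldiff_program n d)))"
proof (rule finite_nogood_entities)
  fix r assume "r \<in> set (alldiff_program n d)"
  then show "finite (heads r) \<and> finite (body_atoms (body_of r))"
    by (cases rule: alldiff_rule_cases) auto
qed

text \<open>A nogood with an element that the completion complements is settled at once
  (\<open>false\<close>). What remains is the at-least nogood of a row, which is the unit rule of
  \<open>closed\<close>, and the pairs of literals under a cardinality body, which are its row and
  column rules.\<close>

lemma stable_completion:
  assumes S: "closed n d S" and d: "n = 0 \<or> d \<ge> 1"
  shows "stable (nogoods (alldiff_program n d)) (completion n d S)"
proof -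
  let ?P = "alldiff_program n d" and ?A = "completion n d S"
  have bodies: "?A (Body (body_of r)) = Some (body_of r = Conj {} \<or> body_of r = Conj {Neg Violate})"
    if "r \<in> set ?P" for r
    using that by (simp add: completion_def)
  \<comment> \<open>If the complemented element is \<open>(x, b)\<close>, the claim is its value;
    otherwise it contradicts the assumption that all other elements hold.\<close>
  have false: "?A x = Some (\<not> b)"
    if "(y, c) \<in> \<delta>" "?A y = Some (\<not> c)" "(x, b) \<in> \<delta>" "\<forall>(y, c) \<in> \<delta> - {(x, b)}. ?A y = Some c"
    for \<delta> x b y c
  proof (cases "(y, c) = (x, b)")
    case False
    with that(1,4) have "?A y = Some c" by blast
    with that(2) show ?thesis by simp
  qed (use that in simp)
  show ?thesis
    unfolding stable_def
  proof (intro ballI allI impI)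
    fix \<delta> x b
    assume \<delta>: "\<delta> \<in> nogoods ?P" and x: "(x, b) \<in> \<delta>" "\<forall>(y, c) \<in> \<delta> - {(x, b)}. ?A y = Some c"
    note false = false[OF _ _ x]
    have others: "?A y = Some c" if "(y, c) \<in> \<delta>" "(y, c) \<noteq> (x, b)" for y c
      using x(2) that by blast
    have card2: "?A x = Some (\<not> b)"
      if B: "\<delta> \<in> body_nogoods (Card 2 L)" "?A (Body (Card 2 L)) = Some False"
        and L: "\<And>l. l \<in> L \<Longrightarrow> \<exists>a. l = Pos a"
        and excl: "\<And>a a'. Pos a \<in> L \<Longrightarrow> Pos a' \<in> L \<Longrightarrow> a \<noteq> a' \<Longrightarrow>
              ?A (Atom a) = Some True \<Longrightarrow> ?A (Atom a') = Some False" for L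
    proof -
      consider T where "T \<subseteq> L" "card T = 2" "\<delta> = insert (Body (Card 2 L), False) (lit_true ` T)"
        | "(Body (Card 2 L), True) \<in> \<delta>"
        using B(1) by auto
      then show ?thesis
      proof cases
        case 1
        from \<open>card T = 2\<close> obtain l l' where T: "T = {l, l'}" "l \<noteq> l'" by (auto simp: card_2_iff)
        with 1(1) L obtain a a' where a: "l = Pos a" "l' = Pos a'" by (metis insert_subset)
        have \<delta>: "\<delta> = {(Body (Card 2 L), False), (Atom a, True), (Atom a', True)}" "a \<noteq> a'"
          using 1(3) T a by auto
        have "Pos a \<in> L" "Pos a' \<in> L" using 1(1) T a by auto
        note e = excl[OF this] excl[OF this(2,1)]
        from x(1) \<delta> consider "x = Body (Card 2 L)" "b = False" | "x = Atom a" "b = True" | "x = Atom a'" "b = True"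
          by blast
        then show ?thesis
        proof cases
          case 1
          with others \<delta> have "?A (Atom a) = Some True" "?A (Atom a') = Some True" by auto
          with e \<delta>(2) show ?thesis by auto
        next
          case 2
          with others \<delta> have "?A (Atom a') = Some True" by auto
          with e \<delta>(2) 2 show ?thesis by auto
        next
          case 3
          with others \<delta> have "?A (Atom a) = Some True" by auto
          with e \<delta>(2) 3 show ?thesis by auto
        qed
      next
        case 2
        then show ?thesis by (rule false) (simp add: B(2))
      qed
    qed
    from \<delta> show "?A x = Some (\<not> b)"
    proof (cases rule: nogoods_cases)
      case (body r)
      note val = bodies[OF body(1)]
      from body(1) show ?thesis
      proof (cases rule: alldiff_rule_cases)
        case (choice v)
        with body(2) val show ?thesis by (intro false[of "Body (Conj {})" False]) auto
      next
        case (atleast v)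
        let ?L = "(\<lambda>i. Neg (E v i)) ` {1..d}"
        from atleast d have L: "?L \<noteq> {}" "?L \<noteq> {Neg Violate}" by auto
        from atleast L val have B: "?A (Body (Conj ?L)) = Some False" by simp
        from body(2) atleast consider "\<delta> = insert (Body (Conj ?L), False) (lit_true ` ?L)"
          | "(Body (Conj ?L), True) \<in> \<delta>" by auto
        then show ?thesis
        proof cases
          case 1
          then have E: "(Atom (E v i), False) \<in> \<delta>" if "i \<in> {1..d}" for i using that by force
          from 1 x(1) consider "x = Body (Conj ?L)" "b = False"
            | i where "i \<in> {1..d}" "x = Atom (E v i)" "b = False" by auto
          then show ?thesis
          proof cases
            case x: 1
            have "S v i = Some False" if "i \<in> {1..d}" for i
              using others[OF E[OF that]] x atleast(1) that by simp
            \<comment> \<open>A cell exists because \<open>d \<ge> 1\<close>; in a row that is false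
              throughout it would have to be true.\<close>
            moreover have "1 \<in> {1..d}" using d atleast(1) by auto
            ultimately show ?thesis using S atleast(1) unfolding closed_def by (metis option.inject)
          next
            case x: (2 i)
            have "S v j = Some False" if "j \<in> {1..d}" "j \<noteq> i" for j
              using others[OF E[OF that(1)]] x atleast(1) that by simp
            with S x atleast(1) have "S v i = Some True" unfolding closed_def by blast
            with x atleast(1) show ?thesis by simp
          qed
        next
          case 2
          then show ?thesis by (rule false) (use B in simp)
        qed
      next
        case (atmost v)
        let ?L = "(\<lambda>i. Pos (E v i)) ` {1..d}"
        show ?thesis
        proof (rule card2[of ?L])
          show "\<delta> \<in> body_nogoods (Card 2 ?L)" using body(2) atmost by simp
          show "?A (Body (Card 2 ?L)) = Some False" using val atmost by simp
          fix a a' assume "Pos a \<in> ?L" "Pos a' \<in> ?L" "a \<noteq> a'" "?A (Atom a) = Some True"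
          then show "?A (Atom a') = Some False" using atmost(1) closedD_row[OF S] by fastforce
        qed auto
      next
        case (column i)
        let ?L = "(\<lambda>v. Pos (E v i)) ` {1..n}"
        show ?thesis
        proof (rule card2[of ?L])
          show "\<delta> \<in> body_nogoods (Card 2 ?L)" using body(2) column by simp
          show "?A (Body (Card 2 ?L)) = Some False" using val column by simp
          fix a a' assume "Pos a \<in> ?L" "Pos a' \<in> ?L" "a \<noteq> a'" "?A (Atom a) = Some True"
          then show "?A (Atom a') = Some False" using column(1) closedD_col[OF S] by fastforce
        qed auto
      next
        case sat
        with body(2) consider "(Body (Conj {Neg Violate}), False) \<in> \<delta>" | "(Atom Violate, True) \<in> \<delta>" by auto
        then show ?thesis by cases (erule false, use sat val in simp)+
      next
        case violate
        with body(2) consider "(Body (Conj {Neg Sat}), True) \<in> \<delta>" | "(Atom Sat, False) \<in> \<delta>" by auto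
        then show ?thesis by cases (erule false, use violate val in simp)+
      qed
    next
      case (head h B)
      from head(1) consider "h = Sat" | "?A (Body B) = Some False"
      proof (cases rule: alldiff_rule_cases)
        case (atleast v)
        with d have "B \<noteq> Conj {}" "B \<noteq> Conj {Neg Violate}" by auto
        then have "?A (Body B) = Some False" using bodies[OF head(1)] by simp
        then show ?thesis by (rule that)
      qed (use bodies[OF head(1)] in \<open>auto intro: that\<close>)
      then show ?thesis
      proof cases
        case 1
        then show ?thesis by (intro false[of "Atom Sat" False]) (simp_all add: head)
      next
        case 2
        then show ?thesis by (intro false[of "Body B" True]) (simp_all add: head)
      qed
    next
      case (support a)
      have E: "?A x = Some (\<not> b)" if "r \<in> set ?P" "a \<in> heads r" "?A (Body (body_of r)) = Some True" for r
        using that support by (intro false[of "Body (body_of r)" False]) auto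
      from support(1) show ?thesis
      proof (cases rule: atoms_alldiff_program)
        case 2
        have "Rule Sat (Conj {Neg Violate}) \<in> set ?P" by (simp add: set_alldiff_program)
        from E[OF this] bodies[OF this] 2 show ?thesis by simp
      next
        case (4 v i)
        then have "Choice (E v ` {1..d}) (Conj {}) \<in> set ?P" by (auto simp: set_alldiff_program)
        from E[OF this] bodies[OF this] 4 show ?thesis by simp
      qed (use support in \<open>auto intro!: false[of "Atom a" True]\<close>)
    next
      case Bot
      then show ?thesis by (intro false[of "Atom Bot" True]) auto
    qed
  qed
qed


lemma stable_rule_false:
  assumes "stable (nogoods P) A" "Rule h B \<in> set P" "A (Atom h) = Some False"
  shows "A (Body B) = Some False"
  using stable_insertD[OF assms(1) nogood_head[OF assms(2)]] assms(3) by simp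

lemma stable_card2:
  assumes st: "stable (nogoods P) A" and r: "r \<in> set P" "body_of r = Card 2 L" "A (Body (Card 2 L)) = Some False"
    and a: "Pos a \<in> L" "Pos a' \<in> L" "a \<noteq> a'" "A (Atom a) = Some True"
  shows "A (Atom a') = Some False"
proof -
  let ?\<delta> = "insert (Body (Card 2 L), False) (lit_true ` {Pos a, Pos a'})"
  have "{Pos a, Pos a'} \<subseteq> L \<and> card {Pos a, Pos a'} = 2" using a by simp
  then have "?\<delta> \<in> body_nogoods (body_of r)" unfolding r(2) body_nogoods.simps by blast
  from nogood_body[OF r(1) this] have "?\<delta> \<in> nogoods P" .
  then have "insert (Atom a', True) {(Body (Card 2 L), False), (Atom a, True)} \<in> nogoods P"
    by (simp add: insert_commute)
  from stable_insertD[OF st this] r(3) a show ?thesis by simp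
qed

text \<open>Converse of \<open>stable_completion\<close>. Falsity of \<open>Bot\<close> and
  \<open>Violate\<close> passes to all bodies of rules with these heads, and with those bodies false
  their nogoods reduce to the grid rules. The second part is only an inclusion, because stability
  says nothing about entities outside the program.\<close>

lemma stable_alldiff:
  assumes st: "stable (nogoods (alldiff_program n d)) A"
    and vio: "A (Atom Violate) = Some False" and d: "n = 0 \<or> d \<ge> 1"
  shows "closed n d (\<lambda>v i. A (Atom (E v i)))" (is ?closed)
    and "completion n d (\<lambda>v i. A (Atom (E v i))) \<subseteq>\<^sub>m A" (is ?le)
proof -
  let ?P = "alldiff_program n d"
  have bot: "A (Atom Bot) = Some False"
    using stable_insertD[OF st nogood_Bot] by simp
  note false = stable_rule_false[OF st]
  have satbody: "A (Body (Conj {Neg Violate})) = Some True"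
  proof -
    have "Rule Sat (Conj {Neg Violate}) \<in> set ?P" by (simp add: set_alldiff_program)
    from nogood_body[OF this, of "{(Body (Conj {Neg Violate}), False), (Atom Violate, False)}"]
    have "{(Body (Conj {Neg Violate}), False), (Atom Violate, False)} \<in> nogoods ?P" by auto
    from stable_insertD[OF st this] vio show ?thesis by simp
  qed
  have sat: "A (Atom Sat) = Some True"
  proof -
    have "Rule Sat (Conj {Neg Violate}) \<in> set ?P" by (simp add: set_alldiff_program)
    from nogood_head[OF this] have "insert (Atom Sat, False) {(Body (Conj {Neg Violate}), True)} \<in> nogoods ?P"
      by (simp add: insert_commute)
    from stable_insertD[OF st this] satbody show ?thesis by simp
  qed
  have bodies: "A (Body (body_of r)) = Some (body_of r = Conj {} \<or> body_of r = Conj {Neg Violate})"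
    if r: "r \<in> set ?P" for r
    using r
  proof (cases rule: alldiff_rule_cases)
    case (choice v)
    from nogood_body[OF r, of "{(Body (Conj {}), False)}"] choice
    have "{(Body (Conj {}), False)} \<in> nogoods ?P" by auto
    from stable_insertD[OF st this] choice show ?thesis by simp
  next
    case (atleast v)
    then have "body_of r \<noteq> Conj {}" "body_of r \<noteq> Conj {Neg Violate}" using d by auto
    with atleast r bot show ?thesis using false[of Bot "body_of r"] by simp
  next
    case (atmost v)
    with r bot show ?thesis using false[of Bot "body_of r"] by simp
  next
    case (column i)
    with r vio show ?thesis using false[of Violate "body_of r"] by simp
  next
    case sat
    with satbody show ?thesis by simp
  next
    case violate
    with r vio show ?thesis using false[of Violate "body_of r"] by simp
  qed
  show ?closed
    unfolding closed_def
  proof (intro ballI conjI impI)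
    fix v i j assume *: "v \<in> {1..n}" "i \<in> {1..d}" "A (Atom (E v i)) = Some True" "j \<in> {1..d}" "j \<noteq> i"
    define r where "r = Rule Bot (Card 2 ((\<lambda>i. Pos (E v i)) ` {1..d}))"
    have r: "r \<in> set ?P" using *(1) by (auto simp: set_alldiff_program r_def)
    show "A (Atom (E v j)) = Some False"
      using stable_card2[OF st r, of _ "E v i" "E v j"] bodies[OF r] * by (simp add: r_def)
  next
    fix v i w assume *: "v \<in> {1..n}" "i \<in> {1..d}" "A (Atom (E v i)) = Some True" "w \<in> {1..n}" "w \<noteq> v"
    define r where "r = Rule Violate (Card 2 ((\<lambda>v. Pos (E v i)) ` {1..n}))"
    have r: "r \<in> set ?P" using *(2) by (auto simp: set_alldiff_program r_def)
    show "A (Atom (E w i)) = Some False"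
      using stable_card2[OF st r, of _ "E v i" "E w i"] bodies[OF r] * by (simp add: r_def image_iff)
  next
    fix v i assume *: "v \<in> {1..n}" "i \<in> {1..d}" "\<forall>j\<in>{1..d}. j \<noteq> i \<longrightarrow> A (Atom (E v j)) = Some False"
    let ?L = "(\<lambda>i. Neg (E v i)) ` {1..d}"
    define r where "r = Rule Bot (Conj ?L)"
    have r: "r \<in> set ?P" using *(1) by (auto simp: set_alldiff_program r_def)
    have "?L \<noteq> {}" "?L \<noteq> {Neg Violate}" using *(2) by auto
    then have B: "A (Body (Conj ?L)) = Some False" using bodies[OF r] by (simp add: r_def)
    have N: "insert (Body (Conj ?L), False) (lit_true ` ?L) \<in> nogoods ?P" (is "?\<delta> \<in> _")
      using nogood_body[OF r, of ?\<delta>] by (simp add: r_def)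
    have "A (Atom (E v i)) = Some (\<not> False)"
    proof (rule stableD[OF st N])
      show "(Atom (E v i), False) \<in> ?\<delta>" using *(2) by (auto simp: image_image)
    qed (use B * in auto)
    then show "A (Atom (E v i)) = Some True" by simp
  qed
  show ?le
    unfolding map_le_def
  proof
    fix x assume x: "x \<in> dom (completion n d (\<lambda>v i. A (Atom (E v i))))"
    show "completion n d (\<lambda>v i. A (Atom (E v i))) x = A x"
    proof (cases x)
      case (Atom a)
      with x show ?thesis by (cases a) (auto simp: completion_def bot sat vio split: if_splits)
    next
      case (Body B)
      with x bodies show ?thesis by (force simp: completion_def split: if_splits)
    qed
  qed
qed

section \<open>Order on grids, and the least closed grid above a start\<close>

definition grid_le :: "nat \<Rightarrow> nat \<Rightarrow> (nat \<Rightarrow> nat \<Rightarrow> bool option) \<Rightarrow> (nat \<Rightarrow> nat \<Rightarrow> bool option) \<Rightarrow> bool" where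
  "grid_le n d T S \<longleftrightarrow> (\<forall>v\<in>{1..n}. \<forall>i\<in>{1..d}. T v i \<noteq> None \<longrightarrow> S v i = T v i)"

lemma completion_mono: "grid_le n d T S \<Longrightarrow> completion n d T \<subseteq>\<^sub>m completion n d S"
  by (auto simp: grid_le_def map_le_def completion_def split: entity.splits atom.splits if_splits)

lemma completion_le_iff:
  assumes "completion n d T \<subseteq>\<^sub>m completion n d S"
  shows "grid_le n d T S"
  unfolding grid_le_def
proof (intro ballI impI)
  fix v i assume "v \<in> {1..n}" "i \<in> {1..d}" "T v i \<noteq> None"
  then have "completion n d T (Atom (E v i)) = T v i" "completion n d S (Atom (E v i)) = S v i"
      "Atom (E v i) \<in> dom (completion n d T)"
    by (simp_all add: domIff)
  with assms show "S v i = T v i" by (simp add: map_le_def)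
qed

text \<open>Leaves open how much of the completion \<open>A\<close> contains beyond the cells and
  \<open>Violate\<close>. This covers the root, where nothing else is assigned, as well as the
  assignment after a decision, where all other entities of the program already have their
  values.\<close>

definition starts :: "nat \<Rightarrow> nat \<Rightarrow> (nat \<Rightarrow> nat \<Rightarrow> bool option) \<Rightarrow> assignment \<Rightarrow> bool" where
  "starts n d T A \<longleftrightarrow> A (Atom Violate) = Some False \<and> A \<subseteq>\<^sub>m completion n d T \<and>
     (\<forall>v\<in>{1..n}. \<forall>i\<in>{1..d}. A (Atom (E v i)) = T v i)"

lemma fixpoint_no_conflict:
  assumes "up_fixpoint (nogoods (alldiff_program n d)) A0 A" "starts n d T A0" "n = 0 \<or> d \<ge> 1"
    and "\<not> conflict (nogoods (alldiff_program n d)) A"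
  obtains S where "closed n d S" "grid_le n d T S" "A = completion n d S"
proof -
  define S where "S = (\<lambda>v i. A (Atom (E v i)))"
  let ?N = "nogoods (alldiff_program n d)"
  from assms(1) have steps: "(up_step ?N)\<^sup>*\<^sup>* A0 A" and fp: "\<nexists>A'. up_step ?N A A'"
    by (auto simp: up_fixpoint_def)
  have le: "A0 \<subseteq>\<^sub>m A" by (rule up_steps_map_le[OF steps])
  have vio: "A (Atom Violate) = Some False"
    using le assms(2) by (auto simp: starts_def map_le_def dom_def)
  note * = stable_alldiff[OF fixpoint_stable[OF fp assms(4)] vio assms(3), folded S_def]
  have TS: "grid_le n d T S"
    unfolding grid_le_def S_def
  proof (intro ballI impI)
    fix v i assume "v \<in> {1..n}" "i \<in> {1..d}" "T v i \<noteq> None"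
    with assms(2) have "A0 (Atom (E v i)) = T v i" "Atom (E v i) \<in> dom A0"
      by (simp_all add: starts_def domIff)
    with le show "A (Atom (E v i)) = T v i" by (simp add: map_le_def)
  qed
  \<comment> \<open>This squeezes \<open>A\<close>: derivations from \<open>A0\<close> stay below
    the stable completion, and \<open>stable_alldiff\<close> gives the other inclusion.\<close>
  have "A0 \<subseteq>\<^sub>m completion n d S"
    using assms(2) completion_mono[OF TS] unfolding starts_def by (blast intro: map_le_trans)
  from up_steps_below_stable[OF steps stable_completion[OF *(1) assms(3)] this]
  have "A = completion n d S" using *(2) by (rule map_le_antisym)
  with *(1) TS show ?thesis by (rule that)
qed

text \<open>Together with \<open>fixpoint_no_conflict\<close> this makes a conflict-free fixpoint
  the least closed grid above \<open>T\<close>, and shows that a conflict rules out every closed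
  grid above \<open>T\<close>.\<close>

lemma fixpoint_below_closed:
  assumes "up_fixpoint (nogoods (alldiff_program n d)) A0 A" "starts n d T A0" "n = 0 \<or> d \<ge> 1"
    and "closed n d S" "grid_le n d T S"
  shows "\<not> conflict (nogoods (alldiff_program n d)) A" "A \<subseteq>\<^sub>m completion n d S"
proof -
  have st: "stable (nogoods (alldiff_program n d)) (completion n d S)"
    by (rule stable_completion) fact+
  have "A0 \<subseteq>\<^sub>m completion n d S"
    using assms(2) completion_mono[OF assms(5)] unfolding starts_def by (blast intro: map_le_trans)
  with assms(1) st show le: "A \<subseteq>\<^sub>m completion n d S"
    by (auto simp: up_fixpoint_def intro: up_steps_below_stable)
  show "\<not> conflict (nogoods (alldiff_program n d)) A"
    by (rule below_stable_no_conflict[OF st le nogoods_nonempty])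
qed

section \<open>Arc consistency\<close>

definition initial_grid :: "domains \<Rightarrow> nat \<Rightarrow> nat \<Rightarrow> bool option" where
  "initial_grid D v i = (if i \<in> D v then None else Some False)"

lemma starts_initial: "starts n d (initial_grid D) (initial_assignment n d D)"
  by (auto simp: starts_def initial_assignment_def initial_grid_def map_le_def completion_def split: if_splits)

text \<open>The maximum is attained by the union \<open>U\<close>: a support found in one of the
  subdomains is still present in \<open>U\<close>.\<close>

lemma enforce_ac_greatest:
  shows "enforce_ac C D \<le> D" "arc_consistent C (enforce_ac C D)"
    and "D' \<le> D \<Longrightarrow> arc_consistent C D' \<Longrightarrow> D' \<le> enforce_ac C D"
proof -
  define U where "U v = (\<Union>D' \<in> {D'. D' \<le> D \<and> arc_consistent C D'}. D' v)" for v
  have U: "U \<le> D \<and> arc_consistent C U"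
  proof
    show "U \<le> D" by (auto simp: U_def le_fun_def)
    show "arc_consistent C U"
      unfolding arc_consistent_def
    proof clarify
      fix v w R assume C: "(v, w, R) \<in> C"
      show "(\<forall>a\<in>U v. \<exists>b\<in>U w. R a b) \<and> (\<forall>b\<in>U w. \<exists>a\<in>U v. R a b)"
      proof (intro conjI ballI)
        fix a assume "a \<in> U v"
        then obtain D' where D': "D' \<le> D" "arc_consistent C D'" "a \<in> D' v" by (auto simp: U_def)
        with C obtain b where "b \<in> D' w" "R a b" unfolding arc_consistent_def by blast
        with D' show "\<exists>b\<in>U w. R a b" by (auto simp: U_def)
      next
        fix b assume "b \<in> U w"
        then obtain D' where D': "D' \<le> D" "arc_consistent C D'" "b \<in> D' w" by (auto simp: U_def)
        with C obtain a where "a \<in> D' v" "R a b" unfolding arc_consistent_def by blast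
        with D' show "\<exists>a\<in>U v. R a b" by (auto simp: U_def)
      qed
    qed
  qed
  have above: "D' \<le> U" if "D' \<le> D \<and> arc_consistent C D'" for D'
    using that by (auto simp: U_def le_fun_def)
  have "enforce_ac C D = U"
    unfolding enforce_ac_def using U above by (intro Greatest_equality) auto
  with U above show "enforce_ac C D \<le> D" "arc_consistent C (enforce_ac C D)"
    "D' \<le> D \<Longrightarrow> arc_consistent C D' \<Longrightarrow> D' \<le> enforce_ac C D" by auto
qed

lemma arc_consistent_neq:
  "arc_consistent (neq_decomposition n) D \<longleftrightarrow>
     (\<forall>v\<in>{1..n}. \<forall>w\<in>{1..n}. v \<noteq> w \<longrightarrow> (\<forall>a\<in>D v. \<exists>b\<in>D w. a \<noteq> b))"
  (is "?L \<longleftrightarrow> ?R")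
proof
  assume ?L
  then have *: "(\<forall>a\<in>D i. \<exists>b\<in>D j. a \<noteq> b) \<and> (\<forall>b\<in>D j. \<exists>a\<in>D i. a \<noteq> b)"
    if "1 \<le> i" "i < j" "j \<le> n" for i j
    using that unfolding arc_consistent_def neq_decomposition_def by auto
  show ?R
  proof (intro ballI impI)
    fix v w a assume "v \<in> {1..n}" "w \<in> {1..n}" "v \<noteq> w" "a \<in> D v"
    then show "\<exists>b\<in>D w. a \<noteq> b" using *[of v w] *[of w v] by (cases "v < w") fastforce+
  qed
next
  assume R: ?R
  show ?L
    unfolding arc_consistent_def neq_decomposition_def
  proof clarify
    fix i j assume "1 \<le> i" "i < j" "j \<le> n"
    then have "\<forall>a\<in>D i. \<exists>b\<in>D j. a \<noteq> b" "\<forall>a\<in>D j. \<exists>b\<in>D i. a \<noteq> b"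
      using R[rule_format, of i j] R[rule_format, of j i] by simp_all
    then show "(\<forall>a\<in>D i. \<exists>b\<in>D j. a \<noteq> b) \<and> (\<forall>b\<in>D j. \<exists>a\<in>D i. a \<noteq> b)"
      by metis
  qed
qed

text \<open>Outside \<open>{1..n}\<close> the domains of \<open>D\<close> are kept, because the
  order on \<open>domains\<close> compares all variables, while the constraints mention only
  \<open>{1..n}\<close>.\<close>

definition grid_domains :: "nat \<Rightarrow> nat \<Rightarrow> domains \<Rightarrow> (nat \<Rightarrow> nat \<Rightarrow> bool option) \<Rightarrow> domains" where
  "grid_domains n d D S v = (if v \<in> {1..n} then {i \<in> {1..d}. S v i \<noteq> Some False} else D v)"

text \<open>A value \<open>a\<close> of \<open>v\<close> lacks support in \<open>w\<close> only if
  \<open>w\<close> has no candidate besides \<open>a\<close>. Then the unit rule makes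
  \<open>S w a\<close> true and the column rule makes \<open>S v a\<close> false, so
  \<open>a\<close> was no candidate of \<open>v\<close>.\<close>

lemma closed_grid_domains:
  assumes S: "closed n d S" and T: "grid_le n d (initial_grid D) S" and D: "initial_domains n d D"
  shows "grid_domains n d D S \<le> D" "arc_consistent (neq_decomposition n) (grid_domains n d D S)"
    and "v \<in> {1..n} \<Longrightarrow> grid_domains n d D S v \<noteq> {}"
proof -
  show "grid_domains n d D S \<le> D"
    unfolding le_fun_def
  proof clarify
    fix v i assume i: "i \<in> grid_domains n d D S v"
    show "i \<in> D v"
    proof (rule ccontr)
      assume "i \<notin> D v"
      with i have "v \<in> {1..n}" "i \<in> {1..d}" "initial_grid D v i \<noteq> None" "S v i \<noteq> initial_grid D v i"
        by (auto simp: grid_domains_def initial_grid_def split: if_splits)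
      with T show False unfolding grid_le_def by blast
    qed
  qed
  have ne: "\<exists>i\<in>{1..d}. S v i \<noteq> Some False" if "v \<in> {1..n}" for v
  proof (rule ccontr)
    assume *: "\<not> ?thesis"
    have "D v \<noteq> {}" "D v \<subseteq> {1..d}" using D that by (auto simp: initial_domains_def)
    then have "1 \<in> {1..d}" by fastforce
    with S that * show False unfolding closed_def by (metis option.inject)
  qed
  show "grid_domains n d D S v \<noteq> {}" if "v \<in> {1..n}"
    using ne[OF that] that by (auto simp: grid_domains_def)
  show "arc_consistent (neq_decomposition n) (grid_domains n d D S)"
    unfolding arc_consistent_neq
  proof (intro ballI impI)
    fix v w a assume *: "v \<in> {1..n}" "w \<in> {1..n}" "v \<noteq> w" "a \<in> grid_domains n d D S v"
    then have a: "a \<in> {1..d}" "S v a \<noteq> Some False" by (auto simp: grid_domains_def)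
    show "\<exists>b\<in>grid_domains n d D S w. a \<noteq> b"
    proof (rule ccontr)
      assume "\<not> ?thesis"
      then have "\<forall>j\<in>{1..d}. j \<noteq> a \<longrightarrow> S w j = Some False" using *(2) by (auto simp: grid_domains_def)
      with S *(2) a have "S w a = Some True" unfolding closed_def by blast
      with closedD_col[OF S] *(1-3) a(1) have "S v a = Some False" by blast
      with a show False by simp
    qed
  qed
qed

definition domains_grid :: "domains \<Rightarrow> nat \<Rightarrow> nat \<Rightarrow> bool option" where
  "domains_grid D v i = (if i \<notin> D v then Some False else if D v = {i} then Some True else None)"

text \<open>When \<open>D v\<close> is a singleton \<open>{i}\<close>, arc consistency removes
  \<open>i\<close> from every other domain, as the column rule demands. Nonemptiness turns a row
  that is false off \<open>i\<close> into the singleton \<open>{i}\<close>, as the unit rule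
  demands.\<close>

lemma closed_domains_grid:
  assumes "arc_consistent (neq_decomposition n) D" "\<forall>v\<in>{1..n}. D v \<noteq> {} \<and> D v \<subseteq> {1..d}"
  shows "closed n d (domains_grid D)"
  unfolding closed_def
proof (intro ballI conjI impI)
  fix v i j assume "domains_grid D v i = Some True" "j \<noteq> i"
  then show "domains_grid D v j = Some False" by (auto simp: domains_grid_def split: if_splits)
next
  fix v i w assume *: "v \<in> {1..n}" "w \<in> {1..n}" "domains_grid D v i = Some True" "w \<noteq> v"
  then have "D v = {i}" by (auto simp: domains_grid_def split: if_splits)
  with assms(1)[unfolded arc_consistent_neq, rule_format, of w v i] * have "i \<notin> D w" by auto
  then show "domains_grid D w i = Some False" by (simp add: domains_grid_def)
next
  fix v i assume *: "v \<in> {1..n}" "i \<in> {1..d}" "\<forall>j\<in>{1..d}. j \<noteq> i \<longrightarrow> domains_grid D v j = Some False"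
  have "j \<notin> D v" if "j \<in> {1..d}" "j \<noteq> i" for j
    using *(3) that by (fastforce simp: domains_grid_def split: if_splits)
  with assms(2) *(1) have "D v \<subseteq> {i}" by blast
  with assms(2) *(1) have "D v = {i}" by blast
  then show "domains_grid D v i = Some True" by (simp add: domains_grid_def)
qed

text \<open>Two extremality arguments. Domains read off a conflict-free fixpoint are arc consistent
  and nonempty, hence contained in the greatest ones, which are then nonempty too. The grid of
  nonempty greatest domains is closed, hence above the fixpoint, which therefore falsifies none of
  their values.\<close>

lemma up_enforces_ac_alldiff:
  "up_enforces_ac n d (alldiff_program n d) (neq_decomposition n)"
  unfolding up_enforces_ac_def
proof (intro allI impI conjI)
  fix D assume D: "initial_domains n d D"
  let ?N = "nogoods (alldiff_program n d)" and ?A0 = "initial_assignment n d D"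
  let ?X = "enforce_ac (neq_decomposition n) D"
  show "\<exists>A. up_fixpoint ?N ?A0 A"
    by (rule up_fixpoint_exists[OF finite_alldiff_nogood_entities])
  have d: "n = 0 \<or> d \<ge> 1"
  proof (cases "n = 0")
    case False
    with D have "D 1 \<noteq> {}" "D 1 \<subseteq> {1..d}" by (auto simp: initial_domains_def)
    then show ?thesis by fastforce
  qed simp
  have XD: "?X v \<subseteq> D v" for v using enforce_ac_greatest(1)[of "neq_decomposition n" D] by (simp add: le_fun_def)
  have X: "closed n d (domains_grid ?X)" "grid_le n d (initial_grid D) (domains_grid ?X)"
    if "\<forall>v\<in>{1..n}. ?X v \<noteq> {}"
  proof -
    show "closed n d (domains_grid ?X)"
      using that XD D by (intro closed_domains_grid enforce_ac_greatest(2)) (fastforce simp: initial_domains_def)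
    show "grid_le n d (initial_grid D) (domains_grid ?X)"
      using XD by (auto simp: grid_le_def initial_grid_def domains_grid_def)
  qed
  fix A assume fp: "up_fixpoint ?N ?A0 A"
  have S: "\<forall>v\<in>{1..n}. ?X v \<noteq> {}" "\<forall>v\<in>{1..n}. {i \<in> {1..d}. A (Atom (E v i)) \<noteq> Some False} = ?X v"
    if "\<not> conflict ?N A"
  proof -
    from fp starts_initial d that obtain S where
      S: "closed n d S" "grid_le n d (initial_grid D) S" "A = completion n d S"
      by (rule fixpoint_no_conflict)
    note G = closed_grid_domains[OF S(1,2) D]
    have GX: "grid_domains n d D S v \<subseteq> ?X v" for v
      using enforce_ac_greatest(3)[OF G(1,2)] by (simp add: le_fun_def)
    with G(3) show ne: "\<forall>v\<in>{1..n}. ?X v \<noteq> {}" by blast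
    have AX: "grid_le n d S (domains_grid ?X)"
      using fixpoint_below_closed(2)[OF fp starts_initial d X[OF ne]] S(3) completion_le_iff by blast
    show "\<forall>v\<in>{1..n}. {i \<in> {1..d}. A (Atom (E v i)) \<noteq> Some False} = ?X v"
    proof
      fix v assume v: "v \<in> {1..n}"
      have "{i \<in> {1..d}. A (Atom (E v i)) \<noteq> Some False} = grid_domains n d D S v"
        using v S(3) by (auto simp: grid_domains_def)
      moreover have "?X v \<subseteq> grid_domains n d D S v"
      proof
        fix i assume i: "i \<in> ?X v"
        then have "i \<in> D v" using XD by blast
        then have "i \<in> {1..d}" using D v unfolding initial_domains_def by blast
        moreover have "S v i \<noteq> Some False"
          using AX[unfolded grid_le_def, rule_format, OF v calculation] i
          by (cases "S v i") (auto simp: domains_grid_def split: if_splits)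
        ultimately show "i \<in> grid_domains n d D S v" using v by (simp add: grid_domains_def)
      qed
      ultimately show "{i \<in> {1..d}. A (Atom (E v i)) \<noteq> Some False} = ?X v" using GX by blast
    qed
  qed
  show "conflict ?N A \<longleftrightarrow> (\<exists>v\<in>{1..n}. ?X v = {})"
    using S(1) fixpoint_below_closed(1)[OF fp starts_initial d X] by blast
  assume "\<not> conflict ?N A"
  from S(2)[OF this] show "\<forall>v\<in>{1..n}. {i \<in> {1..d}. A (Atom (E v i)) \<noteq> Some False} = ?X v" .
qed

section \<open>Weakest preconditions with elapsed time\<close>

text \<open>A terminating run is asserted to exist, as \<open>up_total_time\<close> asks. The
  argument \<open>t\<close> is a running clock, so time bounds are ordinary postconditions and
  compose without bookkeeping.\<close>

definition wp :: "com \<Rightarrow> (store \<Rightarrow> nat \<Rightarrow> bool) \<Rightarrow> store \<Rightarrow> nat \<Rightarrow> bool" where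
  "wp c Q s t \<longleftrightarrow> (\<exists>t' s'. exec c s t' s' \<and> Q s' (t + t'))"

inductive_cases exec_SkipE: "exec Skip s t s'"
inductive_cases exec_PutE: "exec (Put x a b) s t s'"
inductive_cases exec_SeqE: "exec (Seq c1 c2) s t s'"
inductive_cases exec_IfE: "exec (If b c1 c2) s t s'"

lemma wp_Skip [simp]: "wp Skip Q s t \<longleftrightarrow> Q s (t + 1)"
  unfolding wp_def by (metis exec_SkipE exec.Skip)

lemma wp_Put [simp]: "wp (Put x a b) Q s t \<longleftrightarrow> Q (put s x (aval a s) (aval b s)) (t + 1)"
  unfolding wp_def by (metis exec_PutE exec.Put)

lemma wp_Seq [simp]: "wp (Seq c1 c2) Q = wp c1 (wp c2 Q)"
proof (intro ext iffI)
  fix s t assume "wp (Seq c1 c2) Q s t"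
  then obtain t' s' where "exec (Seq c1 c2) s t' s'" "Q s' (t + t')" unfolding wp_def by blast
  then show "wp c1 (wp c2 Q) s t"
    unfolding wp_def by (elim exec_SeqE) (auto simp: add.assoc)
next
  fix s t assume "wp c1 (wp c2 Q) s t"
  then obtain t1 s1 t2 s2 where "exec c1 s t1 s1" "exec c2 s1 t2 s2" "Q s2 (t + t1 + t2)"
    unfolding wp_def by blast
  then show "wp (Seq c1 c2) Q s t"
    unfolding wp_def by (intro exI[of _ "t1 + t2"] exI[of _ s2]) (auto simp: add.assoc intro: exec.Seq)
qed

lemma wp_If [simp]: "wp (If b c1 c2) Q s t \<longleftrightarrow> wp (if bval b s then c1 else c2) Q s (t + 1)"
proof
  assume "wp (If b c1 c2) Q s t"
  then obtain t' s' where "exec (If b c1 c2) s t' s'" "Q s' (t + t')" unfolding wp_def by blast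
  then show "wp (if bval b s then c1 else c2) Q s (t + 1)"
    unfolding wp_def by (elim exec_IfE) (auto intro!: exI)
next
  assume "wp (if bval b s then c1 else c2) Q s (t + 1)"
  then obtain t' s' where "exec (if bval b s then c1 else c2) s t' s'" "Q s' (t + 1 + t')"
    unfolding wp_def by blast
  then show "wp (If b c1 c2) Q s t"
    unfolding wp_def
    using exec.IfTrue[of b s c1 t' s' c2] exec.IfFalse[of b s c2 t' s' c1]
    by (intro exI[of _ "1 + t'"] exI[of _ s']) (auto split: if_splits)
qed

lemma wp_mono: "wp c Q s t \<Longrightarrow> (\<And>s' t'. Q s' t' \<Longrightarrow> Q' s' t') \<Longrightarrow> wp c Q' s t"
  unfolding wp_def by blast

text \<open>The measure \<open>\<mu>\<close> serves termination only. Time bounds go into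
  \<open>I\<close>, which sees the clock, so that amortised costs can be stated as clock plus
  potential.\<close>

lemma wp_While:
  fixes \<mu> :: "store \<Rightarrow> nat"
  assumes "I s t"
    and step: "\<And>s t. I s t \<Longrightarrow> bval b s \<Longrightarrow> wp c (\<lambda>s' t'. I s' t' \<and> \<mu> s' < \<mu> s) s (t + 1)"
    and exit: "\<And>s t. I s t \<Longrightarrow> \<not> bval b s \<Longrightarrow> Q s (t + 1)"
  shows "wp (While b c) Q s t"
  using assms(1)
proof (induction "\<mu> s" arbitrary: s t rule: less_induct)
  case less
  show ?case
  proof (cases "bval b s")
    case True
    from step[OF less(2) True] obtain t1 s1 where
      1: "exec c s t1 s1" "I s1 (t + 1 + t1)" "\<mu> s1 < \<mu> s" unfolding wp_def by blast
    from less(1)[OF 1(3,2)] obtain t2 s2 where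
      2: "exec (While b c) s1 t2 s2" "Q s2 (t + 1 + t1 + t2)" unfolding wp_def by blast
    have "exec (While b c) s (1 + t1 + t2) s2" using True 1(1) 2(1) by (rule exec.WhileTrue)
    with 2(2) show ?thesis unfolding wp_def by (metis add.assoc)
  next
    case False
    with exit[OF less(2) False] show ?thesis unfolding wp_def by (blast intro: exec.WhileFalse)
  qed
qed

section \<open>The propagation state\<close>

definition related :: "nat \<Rightarrow> nat \<Rightarrow> nat \<Rightarrow> bool" where
  "related d k l \<longleftrightarrow> k \<noteq> l \<and> (k div d = l div d \<or> k mod d = l mod d)"

text \<open>
  A grid is stored as an array: index \<open>k\<close> stands for row \<open>k div d\<close> and column \<open>k mod d\<close>,
  both counted from \<open>0\<close>, and \<open>0\<close>, \<open>1\<close>, \<open>2\<close> encode unassigned, false and true.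
\<close>

definition closed_codes :: "nat \<Rightarrow> nat \<Rightarrow> (nat \<Rightarrow> nat) \<Rightarrow> bool" where
  "closed_codes n d a \<longleftrightarrow>
     (\<forall>k<n*d. a k \<le> 2) \<and>
     (\<forall>k<n*d. \<forall>l<n*d. a k = 2 \<longrightarrow> related d l k \<longrightarrow> a l = 1) \<and>
     (\<forall>k<n*d. (\<forall>l<n*d. l \<noteq> k \<longrightarrow> l div d = k div d \<longrightarrow> a l = 1) \<longrightarrow> a k = 2)"

definition codes_le :: "nat \<Rightarrow> nat \<Rightarrow> (nat \<Rightarrow> nat) \<Rightarrow> (nat \<Rightarrow> nat) \<Rightarrow> bool" where
  "codes_le n d a b \<longleftrightarrow> (\<forall>k<n*d. a k \<noteq> 0 \<longrightarrow> b k = a k)"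

definition closed_above :: "nat \<Rightarrow> nat \<Rightarrow> (nat \<Rightarrow> nat) \<Rightarrow> (nat \<Rightarrow> nat) set" where
  "closed_above n d T = {S. closed_codes n d S \<and> codes_le n d T S}"

definition candidates :: "nat \<Rightarrow> nat \<Rightarrow> (nat \<Rightarrow> nat) \<Rightarrow> nat \<Rightarrow> nat set" where
  "candidates n d a v = {k. k < n*d \<and> k div d = v \<and> a k \<noteq> 1}"

text \<open>
  Candidate count \<open>c\<close> and candidate sum \<open>m\<close> of each row, queue \<open>q\<close> of length \<open>e\<close> with \<open>h\<close> processed
  entries, conflict flag \<open>cf\<close>.  Only for the rows in \<open>R\<close> has a unique candidate been made true already.
  The last conjunct expresses soundness: if there is a closed grid above the start \<open>T\<close>, then no
  conflict has been reported, and the current array \<open>a\<close> lies below every such grid.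
\<close>

definition prop_inv :: "nat \<Rightarrow> nat \<Rightarrow> (nat \<Rightarrow> nat) \<Rightarrow> nat set \<Rightarrow> (nat \<Rightarrow> nat) \<Rightarrow> (nat \<Rightarrow> nat) \<Rightarrow> (nat \<Rightarrow> nat) \<Rightarrow>
    (nat \<Rightarrow> nat) \<Rightarrow> nat \<Rightarrow> nat \<Rightarrow> nat \<Rightarrow> bool" where
  "prop_inv n d T R a c m q e h cf \<longleftrightarrow>
     (\<forall>k<n*d. a k \<le> 2) \<and>
     (\<forall>v<n. c v = card (candidates n d a v) \<and> m v = \<Sum>(candidates n d a v)) \<and>
     (\<forall>v<n. c v = 0 \<longrightarrow> cf \<noteq> 0) \<and>
     (\<forall>v\<in>R. v < n \<longrightarrow> c v = 1 \<longrightarrow> (\<forall>k\<in>candidates n d a v. a k = 2)) \<and>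
     (\<forall>j<e. q j < n*d \<and> a (q j) = 2) \<and>
     (\<forall>k<n*d. a k = 2 \<longrightarrow> (\<exists>j<e. q j = k)) \<and>
     inj_on q {..<e} \<and> h \<le> e \<and>
     (cf = 0 \<longrightarrow> (\<forall>j<h. \<forall>k<n*d. related d k (q j) \<longrightarrow> a k = 1)) \<and>
     (\<forall>S\<in>closed_above n d T. cf = 0 \<and> codes_le n d a S)"

lemma finite_candidates [simp]: "finite (candidates n d a v)"
  unfolding candidates_def by simp

lemma div_less_rows: "k < n * d \<Longrightarrow> k div d < (n::nat)"
  by (metis less_mult_imp_div_less)

lemma candidates_falsify:
  "k < n*d \<Longrightarrow> candidates n d (a(k := 1)) v = (if v = k div d then candidates n d a v - {k} else candidates n d a v)"
  by (auto simp: candidates_def)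

lemma candidates_mark:
  "a k = 0 \<Longrightarrow> candidates n d (a(k := 2)) v = candidates n d a v"
  by (auto simp: candidates_def)

text \<open>Row \<open>v\<close> leaves \<open>R\<close>, since its count may just have dropped to
  one without its last candidate having been made true. As \<open>k\<close> was unassigned it is not
  in the queue, whose entries remain true.\<close>

lemma prop_inv_falsify:
  assumes I: "prop_inv n d T R a c m q e h cf" and k: "k < n*d" "a k = 0"
    and S: "\<forall>S\<in>closed_above n d T. S k = 1"
  defines "v \<equiv> k div d"
  shows "prop_inv n d T (R - {v}) (a(k := 1)) (c(v := c v - 1)) (m(v := m v - k)) q e h
           (if c v - 1 = 0 then 1 else cf)"
proof -
  have v: "v < n" unfolding v_def using k(1) by (rule div_less_rows)
  have kc: "k \<in> candidates n d a v" using k by (simp add: candidates_def v_def)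
  note cand = candidates_falsify[OF k(1), of a, folded v_def]
  have cm0: "c w = card (candidates n d a w)" "m w = \<Sum>(candidates n d a w)" if "w < n" for w
    using I that unfolding prop_inv_def by blast+
  have cm: "(c(v := c v - 1)) w = card (candidates n d (a(k := 1)) w)"
    "(m(v := m v - k)) w = \<Sum>(candidates n d (a(k := 1)) w)" if "w < n" for w
    using cm0[OF that] cm0[OF v] kc unfolding cand by (auto simp: card_Diff_singleton sum_diff1_nat)
  have sound: "(if c v - 1 = 0 then 1 else cf) = 0 \<and> codes_le n d (a(k := 1)) S"
    if SA: "S \<in> closed_above n d T" for S
  proof -
    have aS: "codes_le n d a S" "cf = 0" using I SA by (auto simp: prop_inv_def)
    have le: "codes_le n d (a(k := 1)) S" using aS(1) bspec[OF S SA] by (auto simp: codes_le_def)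
    \<comment> \<open>The flag is raised only when \<open>k\<close> was the last candidate. A closed
      grid above \<open>T\<close> would then have the rest of the row false, so its unit rule would
      make \<open>k\<close> true, although \<open>k\<close> is false in all of them.\<close>
    have "c v - 1 \<noteq> 0"
    proof
      assume "c v - 1 = 0"
      with cm(1)[OF v] have "candidates n d (a(k := 1)) v = {}" by simp
      then have "\<forall>l<n*d. l div d = k div d \<longrightarrow> (a(k := 1)) l = 1"
        unfolding candidates_def v_def by blast
      with le have "\<forall>l<n*d. l \<noteq> k \<longrightarrow> l div d = k div d \<longrightarrow> S l = 1"
        unfolding codes_le_def by (metis one_neq_zero)
      then have "S k = 2" using SA k(1) unfolding closed_above_def closed_codes_def by blast
      with bspec[OF S SA] show False by simp
    qed
    with le aS(2) show ?thesis by simp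
  qed
  have R: "\<forall>k'\<in>candidates n d (a(k := 1)) w. (a(k := 1)) k' = 2"
    if "w \<in> R - {v}" "w < n" "(c(v := c v - 1)) w = 1" for w
  proof -
    have "c w = 1" "w \<noteq> v" using that by auto
    with that I have "\<forall>k'\<in>candidates n d a w. a k' = 2" by (simp add: prop_inv_def)
    moreover have "k \<notin> candidates n d a w" using \<open>w \<noteq> v\<close> by (simp add: candidates_def v_def)
    ultimately show ?thesis using \<open>w \<noteq> v\<close> unfolding cand by auto
  qed
  have zero: "(if c v - 1 = 0 then 1 else cf) \<noteq> 0" if "w < n" "(c(v := c v - 1)) w = 0" for w
    using I that by (auto simp: prop_inv_def split: if_splits)
  have nq: "q j \<noteq> k" if "j < e" for j using I that k(2) by (auto simp: prop_inv_def)
  have q: "\<forall>j<e. q j < n*d \<and> (a(k := 1)) (q j) = 2" using I nq by (auto simp: prop_inv_def)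
  have q': "\<forall>l<n*d. (a(k := 1)) l = 2 \<longrightarrow> (\<exists>j<e. q j = l)" using I by (auto simp: prop_inv_def)
  have old: "\<forall>j<h. \<forall>l<n*d. related d l (q j) \<longrightarrow> (a(k := 1)) l = 1"
    if "(if c v - 1 = 0 then 1 else cf) = 0"
    using I that by (auto simp: prop_inv_def split: if_splits)
  have le2: "\<forall>l<n*d. (a(k := 1)) l \<le> 2" using I by (auto simp: prop_inv_def)
  have i: "inj_on q {..<e}" "h \<le> e" using I by (auto simp: prop_inv_def)
  show ?thesis
    unfolding prop_inv_def using le2 cm zero R q q' i old sound by blast
qed

text \<open>Unassigned and true cells both count as candidates, so counts and sums stay correct. The
  cell was unassigned, hence not yet queued, which keeps the queue injective.\<close>

lemma prop_inv_mark:
  assumes I: "prop_inv n d T R a c m q e h cf" and k: "k < n*d" "a k = 0"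
    and S: "\<forall>S\<in>closed_above n d T. S k = 2"
  shows "prop_inv n d T R (a(k := 2)) c m (q(e := k)) (e + 1) h cf"
proof -
  note cand = candidates_mark[of a, OF k(2)]
  have nq: "q j \<noteq> k" if "j < e" for j using I that k(2) by (auto simp: prop_inv_def)
  have inj: "inj_on (q(e := k)) {..<e + 1}"
    using I nq by (fastforce simp: prop_inv_def inj_on_def less_Suc_eq)
  have q': "\<forall>l<n*d. (a(k := 2)) l = 2 \<longrightarrow> (\<exists>j<e+1. (q(e := k)) j = l)"
  proof (intro allI impI)
    fix l assume l: "l < n*d" "(a(k := 2)) l = 2"
    show "\<exists>j<e+1. (q(e := k)) j = l"
    proof (cases "l = k")
      case False
      with l I obtain j where "j < e" "q j = l" by (auto simp: prop_inv_def)
      then show ?thesis by (intro exI[of _ j]) auto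
    qed (auto intro: exI[of _ e])
  qed
  have q: "\<forall>j<e+1. (q(e := k)) j < n*d \<and> (a(k := 2)) ((q(e := k)) j) = 2"
    using I k(1) by (auto simp: prop_inv_def less_Suc_eq)
  have old: "\<forall>j<h. \<forall>l<n*d. related d l ((q(e := k)) j) \<longrightarrow> (a(k := 2)) l = 1" if "cf = 0"
  proof (intro allI impI)
    fix j l assume "j < h" "l < n*d" "related d l ((q(e := k)) j)"
    moreover have "h \<le> e" using I by (simp add: prop_inv_def)
    ultimately have "a l = 1" using I that by (auto simp: prop_inv_def)
    with k(2) show "(a(k := 2)) l = 1" by auto
  qed
  have sound: "cf = 0 \<and> codes_le n d (a(k := 2)) S" if "S \<in> closed_above n d T" for S
    using I bspec[OF S that] that by (auto simp: prop_inv_def codes_le_def)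
  have R: "\<forall>w\<in>R. w < n \<longrightarrow> c w = 1 \<longrightarrow> (\<forall>l\<in>candidates n d (a(k := 2)) w. (a(k := 2)) l = 2)"
    using I unfolding cand by (auto simp: prop_inv_def)
  have rest: "\<forall>k<n*d. a k \<le> 2"
     "\<forall>v<n. c v = card (candidates n d a v) \<and> m v = \<Sum>(candidates n d a v)"
     "\<forall>v<n. c v = 0 \<longrightarrow> cf \<noteq> 0" "h \<le> e" using I by (auto simp: prop_inv_def)
  have le2: "\<forall>l<n*d. (a(k := 2)) l \<le> 2" using rest(1) by auto
  show ?thesis
    unfolding prop_inv_def using le2 rest(2-4)[folded cand[of n d]] R q q' inj old sound
    by (simp add: cand)
qed

lemma prop_inv_checked:
  assumes I: "prop_inv n d T R a c m q e h cf" and v: "c v = 1 \<Longrightarrow> a (m v) = 2"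
  shows "prop_inv n d T (insert v R) a c m q e h cf"
proof -
  have "\<forall>k\<in>candidates n d a v. a k = 2" if "v < n" "c v = 1"
  proof -
    from I that have "card (candidates n d a v) = 1" "m v = \<Sum>(candidates n d a v)" by (auto simp: prop_inv_def)
    then obtain k where "candidates n d a v = {k}" "m v = k" by (auto simp: card_1_singleton_iff)
    with v that show ?thesis by simp
  qed
  with I show ?thesis unfolding prop_inv_def by simp
qed

text \<open>A sum over one index is that index, so \<open>m v\<close> names the sole candidate. The
  rest of the row is false in \<open>a\<close> and thus in every closed grid above \<open>T\<close>,
  whose unit rule makes this cell true.\<close>

lemma prop_inv_unit:
  assumes I: "prop_inv n d T R a c m q e h cf" and v: "v < n" "c v = 1"
  shows "m v < n*d" "a (m v) \<noteq> 1" "a (m v) = 0 \<Longrightarrow> S \<in> closed_above n d T \<Longrightarrow> S (m v) = 2"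
proof -
  from I v have "card (candidates n d a v) = 1" "m v = \<Sum>(candidates n d a v)" by (auto simp: prop_inv_def)
  then obtain k where k: "candidates n d a v = {k}" "m v = k" by (auto simp: card_1_singleton_iff)
  then have kn: "k < n*d" "k div d = v" "a k \<noteq> 1" by (auto simp: candidates_def)
  with k show "m v < n*d" "a (m v) \<noteq> 1" by auto
  assume "S \<in> closed_above n d T"
  then have S: "codes_le n d a S" "closed_codes n d S" using I by (auto simp: prop_inv_def closed_above_def)
  have "a l = 1" if "l < n*d" "l \<noteq> k" "l div d = k div d" for l
    using k(1) kn(2) that by (auto simp: candidates_def)
  with S(1) have "S l = 1" if "l < n*d" "l \<noteq> k" "l div d = k div d" for l
    using that by (simp add: codes_le_def)
  with S(2) kn(1) k(2) show "S (m v) = 2" unfolding closed_codes_def by blast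
qed

lemma prop_inv_conflict:
  assumes "prop_inv n d T R a c m q e h cf" "closed_above n d T = {}"
  shows "prop_inv n d T R a c m q e h 1"
  using assms unfolding prop_inv_def by simp

lemma prop_inv_advance:
  assumes "prop_inv n d T R a c m q e h cf" "h < e"
    and "cf = 0 \<Longrightarrow> \<forall>k<n*d. related d k (q h) \<longrightarrow> a k = 1"
  shows "prop_inv n d T R a c m q e (h + 1) cf"
  using assms unfolding prop_inv_def by (auto simp: less_Suc_eq)

text \<open>Changes the start to one that includes a new decision: closed grids above
  \<open>T'\<close> lie above \<open>a\<close> as well, so nothing derived before has to be
  redone.\<close>

lemma prop_inv_rebase:
  assumes "prop_inv n d T R a c m q e h 0" "codes_le n d a T'"
  shows "prop_inv n d T' R a c m q e h 0"
proof -
  have "codes_le n d a S" if "S \<in> closed_above n d T'" for S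
    using that assms(2) by (auto simp: closed_above_def codes_le_def)
  with assms(1) show ?thesis unfolding prop_inv_def by blast
qed

text \<open>A processed cell has made the rest of its column false, so no later true cell lies in
  that column. The entry at \<open>h\<close>, though unprocessed, is itself a true cell; counting it
  too gives \<open>h + 1\<close> distinct columns.\<close>

lemma prop_inv_head_bound:
  assumes I: "prop_inv n d T R a c m q e h 0" and "h < e" and d: "d \<ge> 1"
  shows "h < d"
proof -
  have "inj_on (\<lambda>j. q j mod d) {..h}"
  proof (rule linorder_inj_onI')
    fix i j assume ij: "i \<in> {..h}" "j \<in> {..h}" "i < j"
    show "q i mod d \<noteq> q j mod d"
    proof
      assume eq: "q i mod d = q j mod d"
      have "inj_on q {..<e}" using I by (simp add: prop_inv_def)
      then have "q i \<noteq> q j" using inj_onD[of q "{..<e}" i j] ij \<open>h < e\<close> by auto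
      with eq have "related d (q j) (q i)" by (simp add: related_def)
      moreover have "q j < n*d" "a (q j) = 2" using I ij \<open>h < e\<close> by (auto simp: prop_inv_def)
      moreover have "i < h" using ij by simp
      ultimately have "a (q j) = 1" using I by (auto simp: prop_inv_def)
      with \<open>a (q j) = 2\<close> show False by simp
    qed
  qed
  then have "card {..h} = card ((\<lambda>j. q j mod d) ` {..h})" by (simp add: card_image)
  also have "\<dots> \<le> card {..<d}" using d by (intro card_mono) auto
  finally show ?thesis by simp
qed

text \<open>With head equal to tail, every true cell has been processed, which yields the row and
  column rules; the unit rule comes from \<open>R\<close>.\<close>

lemma prop_inv_closed:
  assumes I: "prop_inv n d T R a c m q e e 0" and R: "{..<n} \<subseteq> R"
  shows "closed_codes n d a"
  unfolding closed_codes_def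
proof (intro conjI allI impI)
  fix k l assume "k < n*d" "l < n*d" "a k = 2" "related d l k"
  moreover then obtain j where "j < e" "q j = k" using I by (auto simp: prop_inv_def)
  ultimately show "a l = 1" using I by (auto simp: prop_inv_def)
next
  fix k assume k: "k < n*d" "\<forall>l<n*d. l \<noteq> k \<longrightarrow> l div d = k div d \<longrightarrow> a l = 1"
  let ?v = "k div d"
  have v: "?v < n" using k(1) by (rule div_less_rows)
  have sub: "candidates n d a ?v \<subseteq> {k}" using k by (auto simp: candidates_def)
  \<comment> \<open>The clear flag guarantees a candidate in the row, which can only be
    \<open>k\<close>.\<close>
  have "card (candidates n d a ?v) \<noteq> 0" "c ?v = card (candidates n d a ?v)"
    using I v by (auto simp: prop_inv_def)
  with sub have "candidates n d a ?v = {k}" by (auto simp: subset_singleton_iff)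
  moreover have "c ?v = 1" using \<open>c ?v = _\<close> calculation by simp
  ultimately show "a k = 2" using I v R by (auto simp: prop_inv_def)
qed (use I in \<open>auto simp: prop_inv_def\<close>)

lemma prop_inv_sound:
  assumes "prop_inv n d T R a c m q e h cf" "S \<in> closed_above n d T"
  shows "cf = 0" "codes_le n d a S"
  using assms by (auto simp: prop_inv_def)

lemma prop_inv_queue:
  assumes "prop_inv n d T R a c m q e h cf" "h < e"
  shows "q h < n*d" "a (q h) = 2"
  using assms by (auto simp: prop_inv_def)

text \<open>The array also holds \<open>Bot\<close>, \<open>Sat\<close> and \<open>Violate\<close>
  from index \<open>n*d\<close> on, where the invariant does not look.\<close>

lemma prop_inv_cong:
  assumes "prop_inv n d T R a c m q e h cf" "\<And>k. k < n*d \<Longrightarrow> a' k = a k"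
  shows "prop_inv n d T R a' c m q e h cf"
proof -
  have "candidates n d a' v = candidates n d a v" for v using assms(2) by (auto simp: candidates_def)
  moreover have "codes_le n d a' S = codes_le n d a S" for S using assms(2) by (auto simp: codes_le_def)
  moreover have "\<forall>v. \<forall>k\<in>candidates n d a v. a' k = a k" using assms(2) by (auto simp: candidates_def)
  ultimately show ?thesis using assms unfolding prop_inv_def by auto
qed

section \<open>The propagation program\<close>

abbreviation var :: "string \<Rightarrow> aexp" where "var x \<equiv> Get x (Const 0)"
abbreviation assign :: "string \<Rightarrow> aexp \<Rightarrow> com" where "assign x e \<equiv> Put x (Const 0) e"
abbreviation seq (infixr ";;" 60) where "c1 ;; c2 \<equiv> Seq c1 c2"

definition mark :: "aexp \<Rightarrow> com" where
  "mark k = Put ''queue'' (var ''tail'') k ;; assign ''tail'' (Plus (var ''tail'') (Const 1)) ;;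
            Put ''atom'' k (Const 2)"

definition check :: com where
  "check = If (BAnd (Eq (Get ''count'' (var ''row'')) (Const 1))
                    (Eq (Get ''atom'' (Get ''sum'' (var ''row''))) (Const 0)))
              (mark (Get ''sum'' (var ''row''))) Skip"

definition falsify :: com where
  "falsify = assign ''row'' (Get ''var'' (var ''k'')) ;;
     Put ''atom'' (var ''k'') (Const 1) ;;
     Put ''count'' (var ''row'') (Minus (Get ''count'' (var ''row'')) (Const 1)) ;;
     Put ''sum'' (var ''row'') (Minus (Get ''sum'' (var ''row'')) (var ''k'')) ;;
     If (Eq (Get ''count'' (var ''row'')) (Const 0)) (assign ''conflict'' (Const 1)) Skip ;;
     check"

text \<open>Row and column come from tables, since the machine has no division. The disjunction is
  expressed by De Morgan.\<close>

definition related_test :: bexp where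
  "related_test = BAnd (BNot (Eq (var ''k'') (var ''p'')))
     (BNot (BAnd (BNot (Eq (Get ''var'' (var ''k'')) (Get ''var'' (var ''p''))))
                 (BNot (Eq (Get ''val'' (var ''k'')) (Get ''val'' (var ''p''))))))"

definition visit :: com where
  "visit = If related_test
       (If (Eq (Get ''atom'' (var ''k'')) (Const 0)) falsify
         (If (Eq (Get ''atom'' (var ''k'')) (Const 2)) (assign ''conflict'' (Const 1)) Skip))
       Skip ;;
     assign ''k'' (Plus (var ''k'') (Const 1))"

definition process :: com where
  "process = assign ''p'' (Get ''queue'' (var ''head'')) ;; assign ''k'' (Const 0) ;;
     While (Less (var ''k'') (var ''N'')) visit ;;
     assign ''head'' (Plus (var ''head'') (Const 1))"

definition propagate :: com where
  "propagate = While (BAnd (Less (var ''head'') (var ''tail'')) (Eq (var ''conflict'') (Const 0))) process"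

definition resume :: com where
  "resume = assign ''k'' (var ''decision'') ;;
     If (Eq (Get ''decision'' (Const 1)) (Const 0)) falsify (mark (var ''k'')) ;; propagate"

section \<open>Predicates on stores, and what the commands preserve\<close>

definition state_inv :: "nat \<Rightarrow> nat \<Rightarrow> (nat \<Rightarrow> nat) \<Rightarrow> nat set \<Rightarrow> nat \<Rightarrow> store \<Rightarrow> bool" where
  "state_inv n d T R h s \<longleftrightarrow>
     prop_inv n d T R (s ''atom'') (s ''count'') (s ''sum'') (s ''queue'') (s ''tail'' 0) h (s ''conflict'' 0)"

definition tables :: "nat \<Rightarrow> nat \<Rightarrow> store \<Rightarrow> bool" where
  "tables n d s \<longleftrightarrow> s ''N'' 0 = n*d \<and> (\<forall>k<n*d. s ''var'' k = k div d \<and> s ''val'' k = k mod d)"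

text \<open>Follows the order of the rules: three per variable, of which only the choice rule has a
  true body, then the \<open>d\<close> column rules, then the rule for \<open>Sat\<close> and the
  rule from \<open>Sat\<close>. These values are the same at every conflict-free fixpoint, so they
  are written once.\<close>

definition body_code :: "nat \<Rightarrow> nat \<Rightarrow> nat \<Rightarrow> nat" where
  "body_code n d j = (if j < 3*n then (if j mod 3 = 0 then 2 else 1) else if j = 3*n + d then 2 else 1)"

definition fixed_values :: "nat \<Rightarrow> nat \<Rightarrow> store \<Rightarrow> bool" where
  "fixed_values n d s \<longleftrightarrow> s ''atom'' (n*d) = 1 \<and> s ''atom'' (n*d + 1) = 2 \<and> s ''atom'' (n*d + 2) = 1 \<and>
     (\<forall>j < 3*n + d + 2. s ''body'' j = body_code n d j)"

definition extends :: "store \<Rightarrow> store \<Rightarrow> bool" where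
  "extends s s' \<longleftrightarrow> (\<forall>x\<in>{''N'', ''var'', ''val'', ''body''}. s' x = s x) \<and>
     (\<forall>k. s ''atom'' k \<noteq> 0 \<longrightarrow> s' ''atom'' k = s ''atom'' k) \<and>
     (s ''conflict'' 0 \<noteq> 0 \<longrightarrow> s' ''conflict'' 0 \<noteq> 0) \<and>
     s ''tail'' 0 \<le> s' ''tail'' 0 \<and> (\<forall>j < s ''tail'' 0. s' ''queue'' j = s ''queue'' j)"

lemma extends_refl [simp]: "extends s s"
  by (simp add: extends_def)

lemma extends_trans: "extends s s' \<Longrightarrow> extends s' s'' \<Longrightarrow> extends s s''"
  unfolding extends_def by auto

lemma extends_tables: "extends s s' \<Longrightarrow> tables n d s \<Longrightarrow> tables n d s'"
  by (simp add: extends_def tables_def)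

lemma extends_fixed_values: "extends s s' \<Longrightarrow> fixed_values n d s \<Longrightarrow> fixed_values n d s'"
  by (simp add: extends_def fixed_values_def)

lemma extends_codes_le: "extends s s' \<Longrightarrow> codes_le n d T (s ''atom'') \<Longrightarrow> codes_le n d T (s' ''atom'')"
  by (simp add: extends_def codes_le_def)

lemma put_same [simp]: "put s x i k x = (s x)(i := k)"
  by (simp add: put_def)

lemma put_other [simp]: "y \<noteq> x \<Longrightarrow> put s x i k y = s y"
  by (simp add: put_def)

definition keeps_locals :: "store \<Rightarrow> store \<Rightarrow> bool" where
  "keeps_locals s s' \<longleftrightarrow> (\<forall>x\<in>{''k'', ''p'', ''head'', ''n'', ''d''}. s' x = s x)"

text \<open>\<open>mark\<close> evaluates \<open>k\<close> again after changing queue and tail; the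
  last premise ensures that the value is still the same.\<close>

lemma wp_mark:
  assumes I: "state_inv n d T R h s" and k: "aval k s < n*d" "s ''atom'' (aval k s) = 0"
    and S: "\<forall>S\<in>closed_above n d T. S (aval k s) = 2"
    and k': "\<And>f g. aval k (s(''queue'' := f, ''tail'' := g)) = aval k s"
  shows "wp (mark k) (\<lambda>s' t'. state_inv n d T R h s' \<and> extends s s' \<and> keeps_locals s s' \<and>
           s' ''atom'' = (s ''atom'')(aval k s := 2) \<and> s' ''count'' = s ''count'' \<and>
           s' ''sum'' = s ''sum'' \<and> s' ''row'' = s ''row'' \<and> t' = t + 3) s t"
proof -
  have "prop_inv n d T R ((s ''atom'')(aval k s := 2)) (s ''count'') (s ''sum'')
      ((s ''queue'')(s ''tail'' 0 := aval k s)) (s ''tail'' 0 + 1) h (s ''conflict'' 0)"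
    by (rule prop_inv_mark[OF I[unfolded state_inv_def]]) (fact k S)+
  with k(2) k' show ?thesis
    by (auto simp: mark_def state_inv_def extends_def keeps_locals_def put_def)
qed

lemma wp_check:
  assumes I: "state_inv n d T R h s" and v: "s ''row'' 0 < n"
  shows "wp check (\<lambda>s' t'. state_inv n d T (insert (s ''row'' 0) R) h s' \<and> extends s s' \<and>
           keeps_locals s s' \<and> s' ''row'' = s ''row'' \<and> t' \<le> t + 4) s t"
proof (cases "s ''count'' (s ''row'' 0) = 1 \<and> s ''atom'' (s ''sum'' (s ''row'' 0)) = 0")
  case True
  let ?k = "Get ''sum'' (var ''row'')"
  have unit: "aval ?k s < n*d" "\<forall>S\<in>closed_above n d T. S (aval ?k s) = 2"
    using prop_inv_unit[OF I[unfolded state_inv_def] v] True by simp_all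
  have unit0: "s ''atom'' (aval ?k s) = 0" using True by simp
  have "wp (mark ?k) (\<lambda>s' t'. state_inv n d T (insert (s ''row'' 0) R) h s' \<and> extends s s' \<and>
           keeps_locals s s' \<and> s' ''row'' = s ''row'' \<and> t' \<le> t + 4) s (t + 1)"
  proof (rule wp_mono[OF wp_mark[OF I unit(1) unit0 unit(2)]], goal_cases)
    case (2 s' t')
    then have "s' ''count'' = s ''count''" "s' ''atom'' (s' ''sum'' (s ''row'' 0)) = 2" by auto
    with prop_inv_checked[of n d T R "s' ''atom''" "s' ''count''" "s' ''sum''" _ _ h _ "s ''row'' 0"] 2
    show ?case by (auto simp: state_inv_def)
  qed simp_all
  then show ?thesis using True by (simp add: check_def)
next
  case False
  have "s ''atom'' (s ''sum'' (s ''row'' 0)) = 2" if "s ''count'' (s ''row'' 0) = 1"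
  proof -
    note u = prop_inv_unit[OF I[unfolded state_inv_def] v that]
    have "s ''atom'' (s ''sum'' (s ''row'' 0)) \<le> 2"
      using I u(1) unfolding state_inv_def prop_inv_def by blast
    with False u(2) that show ?thesis by linarith
  qed
  then have "state_inv n d T (insert (s ''row'' 0) R) h s"
    using prop_inv_checked[OF I[unfolded state_inv_def], of "s ''row'' 0"] by (simp add: state_inv_def)
  with False show ?thesis by (auto simp: check_def keeps_locals_def)
qed

text \<open>The row of the cell drops out of the checked rows by \<open>prop_inv_falsify\<close>;
  the concluding \<open>check\<close> puts it back.\<close>

lemma wp_falsify:
  assumes I: "state_inv n d T {..<n} h s" and tab: "tables n d s"
    and k: "s ''k'' 0 < n*d" "s ''atom'' (s ''k'' 0) = 0"
    and S: "\<forall>S\<in>closed_above n d T. S (s ''k'' 0) = 1"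
  shows "wp falsify (\<lambda>s' t'. state_inv n d T {..<n} h s' \<and> extends s s' \<and> keeps_locals s s' \<and>
           s' ''atom'' (s ''k'' 0) = 1 \<and> t' \<le> t + 10) s t"
proof -
  let ?k = "s ''k'' 0"
  let ?v = "?k div d"
  define s1 where "s1 = put (put (put (put s ''row'' 0 ?v) ''atom'' ?k 1) ''count'' ?v (s ''count'' ?v - 1))
    ''sum'' ?v (s ''sum'' ?v - ?k)"
  define s2 where "s2 = (if s ''count'' ?v - 1 = 0 then put s1 ''conflict'' 0 1 else s1)"
  have v: "?v < n" using k(1) by (rule div_less_rows)
  have s2: "s2 ''atom'' = (s ''atom'')(?k := 1)" "s2 ''count'' = (s ''count'')(?v := s ''count'' ?v - 1)"
    "s2 ''sum'' = (s ''sum'')(?v := s ''sum'' ?v - ?k)" "s2 ''queue'' = s ''queue''" "s2 ''tail'' = s ''tail''"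
    "s2 ''conflict'' 0 = (if s ''count'' ?v - 1 = 0 then 1 else s ''conflict'' 0)"
    by (auto simp: s2_def s1_def fun_eq_iff)
  have "state_inv n d T ({..<n} - {?v}) h s2"
    unfolding state_inv_def s2 by (rule prop_inv_falsify[OF I[unfolded state_inv_def] k S])
  moreover have row: "s2 ''row'' 0 = ?v" by (simp add: s2_def s1_def)
  moreover have rows: "insert ?v ({..<n} - {?v}) = {..<n}" using v by auto
  ultimately have chk: "wp check (\<lambda>s' t'. state_inv n d T {..<n} h s' \<and> extends s2 s' \<and>
           keeps_locals s2 s' \<and> t' \<le> t + 10) s2 (t + 1 + 1 + 1 + 1 + 1 + 1)"
    using v by (intro wp_mono[OF wp_check[of n d T "{..<n} - {?v}" h s2]]) (auto simp: row rows)
  have ext: "extends s s2" "keeps_locals s s2" "s2 ''atom'' ?k = 1"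
    using k(2) by (auto simp: extends_def keeps_locals_def s2_def s1_def)
  have "wp check (\<lambda>s' t'. state_inv n d T {..<n} h s' \<and> extends s s' \<and> keeps_locals s s' \<and>
           s' ''atom'' (s ''k'' 0) = 1 \<and> t' \<le> t + 10) s2 (t + 1 + 1 + 1 + 1 + 1 + 1)"
  proof (rule wp_mono[OF chk], goal_cases)
    case (1 s' t')
    have e: "extends s2 s'" using 1 by blast
    with ext(3) have "s' ''atom'' ?k = 1" by (simp add: extends_def)
    with 1 extends_trans[OF ext(1) e] ext(2) show ?case by (simp add: keeps_locals_def)
  qed
  moreover have "s ''var'' ?k = ?v" using tab k(1) by (simp add: tables_def)
  ultimately show ?thesis
    by (auto simp: falsify_def s2_def s1_def)
qed


text \<open>The cell at \<open>p\<close> is true in every closed grid above \<open>T\<close>, so a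
  related cell is false in all of them: falsifying it is sound, and if it is already true there is
  no such grid and the conflict is genuine.\<close>

lemma wp_visit:
  assumes I: "state_inv n d T {..<n} h s" and tab: "tables n d s"
    and k: "s ''k'' 0 < n*d" and p: "s ''p'' 0 < n*d" "s ''atom'' (s ''p'' 0) = 2"
  shows "wp visit (\<lambda>s' t'. state_inv n d T {..<n} h s' \<and> extends s s' \<and>
           s' ''p'' = s ''p'' \<and> s' ''head'' = s ''head'' \<and> s' ''k'' 0 = s ''k'' 0 + 1 \<and>
           (related d (s ''k'' 0) (s ''p'' 0) \<longrightarrow> s' ''conflict'' 0 = 0 \<longrightarrow> s' ''atom'' (s ''k'' 0) = 1) \<and>
           t' \<le> t + 13) s t"
proof -
  let ?k = "s ''k'' 0" and ?p = "s ''p'' 0"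
  have test: "bval related_test s \<longleftrightarrow> related d ?k ?p"
    using tab k p(1) by (auto simp: related_test_def related_def tables_def)
  have S1: "S ?k = 1" if "S \<in> closed_above n d T" "related d ?k ?p" for S
  proof -
    have "S ?p = 2" using prop_inv_sound(2)[OF I[unfolded state_inv_def] that(1)] p by (simp add: codes_le_def)
    with that k p(1) show ?thesis unfolding closed_above_def closed_codes_def by blast
  qed
  have le2: "s ''atom'' ?k \<le> 2" using I k by (simp add: state_inv_def prop_inv_def)
  let ?Q = "\<lambda>s' t'. state_inv n d T {..<n} h s' \<and> extends s s' \<and> keeps_locals s s' \<and>
           (related d ?k ?p \<longrightarrow> s' ''conflict'' 0 = 0 \<longrightarrow> s' ''atom'' ?k = 1) \<and> t' \<le> t + 12"
  have "wp (If related_test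
       (If (Eq (Get ''atom'' (var ''k'')) (Const 0)) falsify
         (If (Eq (Get ''atom'' (var ''k'')) (Const 2)) (assign ''conflict'' (Const 1)) Skip)) Skip) ?Q s t"
  proof (cases "related d ?k ?p")
    case False
    with I show ?thesis by (simp add: test keeps_locals_def)
  next
    case True
    consider "s ''atom'' ?k = 0" | "s ''atom'' ?k = 1" | "s ''atom'' ?k = 2" using le2 by linarith
    then show ?thesis
    proof cases
      case 1
      have "\<forall>S\<in>closed_above n d T. S ?k = 1" using S1 True by blast
      from wp_falsify[OF I tab k 1 this, of "t + 2"]
      have "wp falsify ?Q s (t + 2)" by (rule wp_mono) auto
      with 1 True show ?thesis by (simp add: test)
    next
      case 2
      with I True show ?thesis by (simp add: test keeps_locals_def)
    next
      case 3
      have "closed_above n d T = {}"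
      proof (rule ccontr)
        assume "closed_above n d T \<noteq> {}"
        then obtain S where S: "S \<in> closed_above n d T" by blast
        have "S ?k = 2" using prop_inv_sound(2)[OF I[unfolded state_inv_def] S] k 3 by (simp add: codes_le_def)
        with S1[OF S True] show False by simp
      qed
      from prop_inv_conflict[OF I[unfolded state_inv_def] this] True 3 show ?thesis
        by (simp add: test keeps_locals_def extends_def state_inv_def)
    qed
  qed
  then have "wp (If related_test
       (If (Eq (Get ''atom'' (var ''k'')) (Const 0)) falsify
         (If (Eq (Get ''atom'' (var ''k'')) (Const 2)) (assign ''conflict'' (Const 1)) Skip)) Skip)
     (wp (assign ''k'' (Plus (var ''k'') (Const 1))) (\<lambda>s' t'. state_inv n d T {..<n} h s' \<and> extends s s' \<and>
           s' ''p'' = s ''p'' \<and> s' ''head'' = s ''head'' \<and> s' ''k'' 0 = s ''k'' 0 + 1 \<and>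
           (related d (s ''k'' 0) (s ''p'' 0) \<longrightarrow> s' ''conflict'' 0 = 0 \<longrightarrow> s' ''atom'' (s ''k'' 0) = 1) \<and>
           t' \<le> t + 13)) s t"
    by (rule wp_mono) (auto simp: state_inv_def keeps_locals_def extends_def)
  then show ?thesis unfolding visit_def wp_Seq .
qed

lemma wp_process:
  assumes I: "state_inv n d T {..<n} (s ''head'' 0) s" and tab: "tables n d s"
    and hd: "s ''head'' 0 < s ''tail'' 0"
  shows "wp process (\<lambda>s' t'. state_inv n d T {..<n} (s' ''head'' 0) s' \<and> extends s s' \<and>
           s' ''head'' 0 = s ''head'' 0 + 1 \<and> t' \<le> t + 14 * (n*d) + 4) s t"
proof -
  let ?h = "s ''head'' 0" and ?N = "n * d"
  define p where "p = s ''queue'' ?h"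
  have p: "p < ?N" "s ''atom'' p = 2"
    using prop_inv_queue[OF I[unfolded state_inv_def] hd] by (simp_all add: p_def)
  \<comment> \<open>The 14 is 13 for a visit plus 1 for the loop test; the 2 pays for the
    assignments before the loop. The claim on visited cells depends on the flag, because a true
    related cell is left as it is.\<close>
  define J where "J s' t' \<longleftrightarrow> state_inv n d T {..<n} ?h s' \<and> extends s s' \<and> s' ''p'' 0 = p \<and>
     s' ''head'' 0 = ?h \<and> s' ''k'' 0 \<le> ?N \<and>
     (\<forall>j<s' ''k'' 0. related d j p \<longrightarrow> s' ''conflict'' 0 = 0 \<longrightarrow> s' ''atom'' j = 1) \<and>
     t' + 14 * (?N - s' ''k'' 0) \<le> t + 2 + 14 * ?N" for s' t'
  define s1 where "s1 = put (put s ''p'' 0 p) ''k'' 0 0"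
  have "wp (While (Less (var ''k'') (var ''N'')) visit) (\<lambda>s' t'. state_inv n d T {..<n} ?h s' \<and> extends s s' \<and>
     s' ''head'' 0 = ?h \<and> s' ''p'' 0 = p \<and> (s' ''conflict'' 0 = 0 \<longrightarrow> (\<forall>j<?N. related d j p \<longrightarrow> s' ''atom'' j = 1)) \<and>
     t' \<le> t + 3 + 14 * ?N) s1 (t + 2)"
  proof (rule wp_While[where I = J and \<mu> = "\<lambda>s. ?N - s ''k'' 0"], goal_cases)
    case 1
    from I show ?case by (simp add: J_def s1_def state_inv_def extends_def)
  next
    case (2 u t1)
    have u: "state_inv n d T {..<n} ?h u" "extends s u" "u ''p'' 0 = p" "tables n d u" "u ''k'' 0 < ?N"
      using 2 extends_tables[OF _ tab] by (auto simp: J_def tables_def)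
    have "u ''p'' 0 < ?N" "u ''atom'' (u ''p'' 0) = 2" using u(2,3) p by (auto simp: extends_def)
    from wp_visit[OF u(1,4,5) this, of "t1 + 1"] show ?case
    proof (rule wp_mono, goal_cases)
      case (1 s' t')
      have e: "extends u s'" using 1 by blast
      have "s' ''atom'' j = 1" if "j < u ''k'' 0 + 1" "related d j p" "s' ''conflict'' 0 = 0" for j
      proof (cases "j = u ''k'' 0")
        case True
        with 1 that u(3) show ?thesis by simp
      next
        case False
        with that have "j < u ''k'' 0" by simp
        \<comment> \<open>A raised flag is never cleared, so it was clear before this visit as
          well.\<close>
        moreover have "u ''conflict'' 0 = 0" using e that(3) by (auto simp: extends_def)
        ultimately have "u ''atom'' j = 1" using 2(1) that(2) by (simp add: J_def)
        then show ?thesis using e by (simp add: extends_def)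
      qed
      with 1 2(1) u extends_trans[OF u(2) e] show ?case by (auto simp: J_def)
    qed
  next
    case (3 u t1)
    then have "u ''k'' 0 = ?N" using extends_tables[OF _ tab] by (auto simp: J_def tables_def)
    with 3 show ?case by (auto simp: J_def)
  qed
  then have "wp (While (Less (var ''k'') (var ''N'')) visit)
    (wp (assign ''head'' (Plus (var ''head'') (Const 1))) (\<lambda>s' t'. state_inv n d T {..<n} (s' ''head'' 0) s' \<and> extends s s' \<and>
           s' ''head'' 0 = s ''head'' 0 + 1 \<and> t' \<le> t + 14 * (n*d) + 4)) s1 (t + 2)"
  proof (rule wp_mono, goal_cases)
    case (1 u t')
    have J: "prop_inv n d T {..<n} (u ''atom'') (u ''count'') (u ''sum'') (u ''queue'') (u ''tail'' 0) ?h (u ''conflict'' 0)"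
      using 1 by (simp add: state_inv_def)
    have "u ''queue'' ?h = p" "?h < u ''tail'' 0"
      using 1 hd by (auto simp: extends_def p_def)
    with 1 prop_inv_advance[OF J] have "prop_inv n d T {..<n} (u ''atom'') (u ''count'') (u ''sum'')
      (u ''queue'') (u ''tail'' 0) (?h + 1) (u ''conflict'' 0)" by simp
    moreover have "extends s (put u ''head'' 0 (?h + 1))" using 1 by (simp add: extends_def)
    ultimately show ?case using 1 by (simp add: state_inv_def)
  qed
  then show ?thesis by (simp add: process_def s1_def p_def)
qed


section \<open>Time of propagation and of one decision\<close>

definition finished :: "nat \<Rightarrow> nat \<Rightarrow> (nat \<Rightarrow> nat) \<Rightarrow> store \<Rightarrow> bool" where
  "finished n d T s \<longleftrightarrow> state_inv n d T {..<n} (s ''head'' 0) s \<and> tables n d s \<and> fixed_values n d s \<and>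
     codes_le n d T (s ''atom'') \<and> (s ''conflict'' 0 = 0 \<longrightarrow> s ''head'' 0 = s ''tail'' 0)"

text \<open>Upper bound on the time for processing all queue entries that may still come.\<close>

definition credit :: "nat \<Rightarrow> nat \<Rightarrow> store \<Rightarrow> nat" where
  "credit n d s = (14 * (n*d) + 5) * (d - s ''head'' 0)"

text \<open>An iteration costs at most \<open>14 * (n*d) + 5\<close>, test included, and advances
  the head by one, so the drop in credit pays for it. The loop guard excludes a conflict, hence
  \<open>prop_inv_head_bound\<close> applies and the subtraction in \<open>credit\<close> does not
  truncate. The extra 1 is the final test.\<close>

lemma wp_propagate:
  assumes I: "state_inv n d T {..<n} (s ''head'' 0) s" and tab: "tables n d s" and fixed: "fixed_values n d s"
    and T: "codes_le n d T (s ''atom'')" and d: "d \<ge> 1"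
  shows "wp propagate (\<lambda>s' t'. finished n d T s' \<and> t' + credit n d s' \<le> t + credit n d s + 1) s t"
  unfolding propagate_def
proof (rule wp_While[where \<mu> = "\<lambda>s. d - s ''head'' 0" and
    I = "\<lambda>s' t'. state_inv n d T {..<n} (s' ''head'' 0) s' \<and> extends s s' \<and> t' + credit n d s' \<le> t + credit n d s"],
    goal_cases)
  case 1
  from I show ?case by simp
next
  case (2 u t1)
  have tail: "u ''head'' 0 < u ''tail'' 0" "u ''conflict'' 0 = 0" using 2(2) by auto
  have tab': "tables n d u" using 2 extends_tables[OF _ tab] by blast
  have hd: "u ''head'' 0 < d"
    using prop_inv_head_bound[of n d T] 2(1) tail d by (auto simp: state_inv_def)
  from wp_process[OF conjunct1[OF 2(1)] tab' tail(1), of "t1 + 1"] show ?case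
  proof (rule wp_mono, goal_cases)
    case (1 s' t')
    define W where "W = 14 * (n*d) + 5"
    have "credit n d u = W * (d - (u ''head'' 0 + 1)) + W"
      using hd by (simp add: credit_def W_def[symmetric] Suc_diff_Suc[symmetric])
    moreover have "credit n d s' = W * (d - (u ''head'' 0 + 1))" using 1 by (simp add: credit_def W_def)
    moreover have "t' \<le> t1 + W" using 1 by (simp add: W_def)
    moreover have "t1 + credit n d u \<le> t + credit n d s" using 2(1) by blast
    ultimately have "t' + credit n d s' \<le> t + credit n d s" by linarith
    moreover have "extends s s'" using 1 2(1) by (blast intro: extends_trans)
    moreover have "state_inv n d T {..<n} (s' ''head'' 0) s'" using 1 by blast
    ultimately show ?case using 1 hd by auto
  qed
next
  case (3 u t1)
  then have "u ''conflict'' 0 = 0 \<longrightarrow> u ''head'' 0 = u ''tail'' 0"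
    by (auto simp: state_inv_def prop_inv_def)
  with 3 show ?case
    using extends_tables[OF _ tab] extends_fixed_values[OF _ fixed] extends_codes_le T
    by (auto simp: finished_def)
qed

text \<open>At most 12 steps precede propagation, namely one assignment, one test and
  \<open>falsify\<close>; the final loop test makes it 13. All scanning is paid by credit.\<close>

lemma wp_resume:
  assumes fin: "finished n d T0 s" and cf: "s ''conflict'' 0 = 0"
    and dec: "s ''decision'' 0 = k" "s ''decision'' 1 = (if b then 1 else 0)"
    and k: "k < n*d" "s ''atom'' k = 0" and d: "d \<ge> 1"
  defines "T \<equiv> (s ''atom'')(k := if b then 2 else 1)"
  shows "wp resume (\<lambda>s' t'. finished n d T s' \<and> t' + credit n d s' \<le> t + credit n d s + 13) s t"
proof -
  define s1 where "s1 = put s ''k'' 0 k"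
  \<comment> \<open>The decision enters the start grid before it is executed. Every closed grid
    above the new start agrees with it, so writing it is sound.\<close>
  have "codes_le n d (s ''atom'') T" using k(2) by (simp add: codes_le_def T_def)
  with fin cf have I: "state_inv n d T {..<n} (s ''head'' 0) s"
    unfolding finished_def state_inv_def by (metis prop_inv_rebase)
  have I1: "state_inv n d T {..<n} (s ''head'' 0) s1" using I by (simp add: state_inv_def s1_def)
  have e1: "extends s s1" by (simp add: extends_def s1_def)
  have tab1: "tables n d s1" "fixed_values n d s1"
    using fin extends_tables[OF e1] extends_fixed_values[OF e1] by (simp_all add: finished_def)
  have S: "\<forall>S\<in>closed_above n d T. S k = (if b then 2 else 1)"
    using k(1) by (auto simp: closed_above_def codes_le_def T_def)
  let ?Q = "\<lambda>s' t'. state_inv n d T {..<n} (s ''head'' 0) s' \<and> extends s1 s' \<and> keeps_locals s1 s' \<and>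
     s' ''atom'' k = (if b then 2 else 1) \<and> t' \<le> t + 12"
  have k1: "s1 ''k'' 0 = k" "s1 ''atom'' = s ''atom''" "s1 ''decision'' = s ''decision''" by (simp_all add: s1_def)
  have "wp (If (Eq (Get ''decision'' (Const 1)) (Const 0)) falsify (mark (var ''k''))) ?Q s1 (t + 1)"
  proof (cases b)
    case True
    have "wp (mark (var ''k'')) ?Q s1 (t + 2)"
      by (rule wp_mono[OF wp_mark[OF I1]]) (use k1 k S True in auto)
    with True dec k1 show ?thesis by simp
  next
    case False
    have "wp falsify ?Q s1 (t + 2)"
      by (rule wp_mono[OF wp_falsify[OF I1 tab1(1)]]) (use k1 k S False in auto)
    with False dec k1 show ?thesis by simp
  qed
  then have "wp (If (Eq (Get ''decision'' (Const 1)) (Const 0)) falsify (mark (var ''k'')))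
    (wp propagate (\<lambda>s' t'. finished n d T s' \<and> t' + credit n d s' \<le> t + credit n d s + 13)) s1 (t + 1)"
  proof (rule wp_mono, goal_cases)
    case (1 u t1)
    have u: "extends s1 u" "u ''head'' 0 = s ''head'' 0" "t1 \<le> t + 12" "u ''atom'' k = (if b then 2 else 1)"
      using 1 by (simp_all add: keeps_locals_def s1_def)
    have "state_inv n d T {..<n} (u ''head'' 0) u" using 1 u by simp
    moreover have "tables n d u" "fixed_values n d u"
      using tab1 extends_tables[OF u(1)] extends_fixed_values[OF u(1)] by blast+
    moreover have "codes_le n d T (u ''atom'')"
      using u(1,4) by (auto simp: codes_le_def T_def extends_def s1_def)
    ultimately have "wp propagate (\<lambda>s' t'. finished n d T s' \<and> t' + credit n d s' \<le> t1 + credit n d u + 1) u t1"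
      using d by (rule wp_propagate)
    then show ?case by (rule wp_mono) (use u in \<open>auto simp: credit_def\<close>)
  qed
  then show ?thesis using dec by (simp add: resume_def s1_def)
qed

section \<open>Initialisation\<close>

definition init_step :: com where
  "init_step =
     Put ''var'' (var ''k'') (var ''row'') ;; Put ''val'' (var ''k'') (var ''i'') ;;
     If (Eq (Get ''dom'' (var ''k'')) (Const 1))
       (Put ''count'' (var ''row'') (Plus (Get ''count'' (var ''row'')) (Const 1)) ;;
        Put ''sum'' (var ''row'') (Plus (Get ''sum'' (var ''row'')) (var ''k'')))
       (Put ''atom'' (var ''k'') (Const 1)) ;;
     assign ''k'' (Plus (var ''k'') (Const 1)) ;; assign ''i'' (Plus (var ''i'') (Const 1)) ;;
     If (Eq (var ''i'') (var ''d'')) (assign ''i'' (Const 0) ;; assign ''row'' (Plus (var ''row'') (Const 1))) Skip"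

definition body_step :: com where
  "body_step = Put ''body'' (var ''j'') (Const 2) ;;
     Put ''body'' (Plus (var ''j'') (Const 1)) (Const 1) ;;
     Put ''body'' (Plus (var ''j'') (Const 2)) (Const 1) ;;
     assign ''j'' (Plus (var ''j'') (Const 3)) ;; assign ''row'' (Plus (var ''row'') (Const 1))"

definition column_body_step :: com where
  "column_body_step = Put ''body'' (var ''j'') (Const 1) ;;
     assign ''j'' (Plus (var ''j'') (Const 1)) ;; assign ''i'' (Plus (var ''i'') (Const 1))"

definition check_step :: com where
  "check_step = check ;; assign ''row'' (Plus (var ''row'') (Const 1))"

text \<open>Most counters rely on the input store being 0 elsewhere; ''i'' is back at 0 after the
  first loop. The product \<open>n*d\<close> is obtained as the final value of ''k'', since the
  machine cannot multiply.\<close>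

definition start :: com where
  "start =
     While (Less (var ''row'') (var ''n'')) init_step ;;
     assign ''N'' (var ''k'') ;; Put ''atom'' (var ''N'') (Const 1) ;;
     Put ''atom'' (Plus (var ''N'') (Const 1)) (Const 2) ;; Put ''atom'' (Plus (var ''N'') (Const 2)) (Const 1) ;;
     assign ''row'' (Const 0) ;;
     While (Less (var ''row'') (var ''n'')) body_step ;;
     While (Less (var ''i'') (var ''d'')) column_body_step ;;
     Put ''body'' (var ''j'') (Const 2) ;; Put ''body'' (Plus (var ''j'') (Const 1)) (Const 1) ;;
     assign ''row'' (Const 0) ;;
     While (Less (var ''row'') (var ''n'')) check_step ;;
     propagate"

definition dom_codes :: "(nat \<Rightarrow> nat) \<Rightarrow> nat \<Rightarrow> nat" where
  "dom_codes f k = (if f k = 1 then 0 else 1)"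

text \<open>The counters ''row'' and ''i'' stand in for quotient and remainder of ''k''. The clause
  for ''row'' equal to \<open>n\<close> pins ''k'' to exactly \<open>n*d\<close> at loop
  exit.\<close>

definition init_loop_inv :: "nat \<Rightarrow> nat \<Rightarrow> (nat \<Rightarrow> nat) \<Rightarrow> store \<Rightarrow> bool" where
  "init_loop_inv n d f s \<longleftrightarrow>
     s ''n'' 0 = n \<and> s ''d'' 0 = d \<and> s ''dom'' = f \<and> s ''tail'' 0 = 0 \<and> s ''head'' 0 = 0 \<and>
     s ''conflict'' 0 = 0 \<and> s ''j'' 0 = 0 \<and>
     s ''k'' 0 = s ''row'' 0 * d + s ''i'' 0 \<and> s ''i'' 0 < d \<and> s ''row'' 0 \<le> n \<and>
     (s ''row'' 0 = n \<longrightarrow> s ''i'' 0 = 0) \<and>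
     (\<forall>k < s ''k'' 0. s ''var'' k = k div d \<and> s ''val'' k = k mod d) \<and>
     s ''atom'' = (\<lambda>k. if k < s ''k'' 0 then dom_codes f k else 0) \<and>
     (\<forall>v. s ''count'' v = card {k. k < s ''k'' 0 \<and> k div d = v \<and> dom_codes f k \<noteq> 1} \<and>
          s ''sum'' v = \<Sum>{k. k < s ''k'' 0 \<and> k div d = v \<and> dom_codes f k \<noteq> 1})"

lemma wp_init_step:
  assumes I: "init_loop_inv n d f s" and row: "s ''row'' 0 < n"
  shows "wp init_step (\<lambda>s' t'. init_loop_inv n d f s' \<and> s' ''k'' 0 = s ''k'' 0 + 1 \<and> t' \<le> t + 10) s t"
proof -
  let ?k = "s ''k'' 0" and ?r = "s ''row'' 0" and ?i = "s ''i'' 0"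
  have k: "?k = ?r * d + ?i" "?i < d" using I by (simp_all add: init_loop_inv_def)
  have dm: "?k div d = ?r" "?k mod d = ?i" using k by simp_all
  define C where "C K v = {k. k < K \<and> k div d = v \<and> dom_codes f k \<noteq> 1}" for K v
  have fin: "finite (C K v)" for K v by (simp add: C_def)
  have C: "C (Suc ?k) v = (if v = ?r \<and> dom_codes f ?k \<noteq> 1 then insert ?k (C ?k v) else C ?k v)" for v
    using dm by (auto simp: C_def less_Suc_eq)
  have notin: "?k \<notin> C ?k v" for v by (simp add: C_def)
  note I' = I[unfolded init_loop_inv_def, folded C_def]
  define s1 where "s1 = put (put s ''var'' ?k ?r) ''val'' ?k ?i"
  define s2 where "s2 = (if f ?k = 1
      then put (put s1 ''count'' ?r (s ''count'' ?r + 1)) ''sum'' ?r (s ''sum'' ?r + ?k)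
      else put s1 ''atom'' ?k 1)"
  define s3 where "s3 = put (put s2 ''k'' 0 (?k + 1)) ''i'' 0 (?i + 1)"
  define s4 where "s4 = (if ?i + 1 = d then put (put s3 ''i'' 0 0) ''row'' 0 (?r + 1) else s3)"
  have s4: "s4 ''n'' = s ''n''" "s4 ''d'' = s ''d''" "s4 ''dom'' = s ''dom''" "s4 ''tail'' = s ''tail''"
    "s4 ''head'' = s ''head''" "s4 ''conflict'' = s ''conflict''" "s4 ''j'' = s ''j''" "s4 ''k'' 0 = ?k + 1"
    "s4 ''i'' 0 = (if ?i + 1 = d then 0 else ?i + 1)" "s4 ''row'' 0 = (if ?i + 1 = d then ?r + 1 else ?r)"
    "s4 ''var'' = (s ''var'')(?k := ?r)" "s4 ''val'' = (s ''val'')(?k := ?i)"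
    "s4 ''atom'' = (if f ?k = 1 then s ''atom'' else (s ''atom'')(?k := 1))"
    "s4 ''count'' = (if f ?k = 1 then (s ''count'')(?r := s ''count'' ?r + 1) else s ''count'')"
    "s4 ''sum'' = (if f ?k = 1 then (s ''sum'')(?r := s ''sum'' ?r + ?k) else s ''sum'')"
    by (auto simp: s4_def s3_def s2_def s1_def fun_eq_iff)
  have "init_loop_inv n d f s4"
    unfolding init_loop_inv_def C_def[symmetric]
  proof (intro conjI allI impI)
    show "s4 ''k'' 0 = s4 ''row'' 0 * d + s4 ''i'' 0" "s4 ''i'' 0 < d" "s4 ''row'' 0 \<le> n"
      "s4 ''row'' 0 = n \<Longrightarrow> s4 ''i'' 0 = 0"
      using k row unfolding s4 by (auto simp: algebra_simps split: if_splits)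
    show "s4 ''atom'' = (\<lambda>k. if k < s4 ''k'' 0 then dom_codes f k else 0)"
      using I' unfolding s4 by (auto simp: fun_eq_iff dom_codes_def less_Suc_eq)
    show "s4 ''var'' k = k div d" "s4 ''val'' k = k mod d" if "k < s4 ''k'' 0" for k
      using I' dm that unfolding s4 by (auto simp: less_Suc_eq)
    fix v
    have "s ''count'' v = card (C ?k v)" "s ''sum'' v = \<Sum>(C ?k v)" using I' by simp_all
    then show "s4 ''count'' v = card (C (s4 ''k'' 0) v)" "s4 ''sum'' v = \<Sum>(C (s4 ''k'' 0) v)"
      unfolding s4 using fin notin by (auto simp: C dom_codes_def)
  qed (use I' in \<open>simp_all add: s4\<close>)
  moreover have "s ''dom'' = f" "s ''d'' 0 = d" using I' by simp_all
  ultimately show ?thesis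
    using s4(8) by (auto simp: init_step_def s4_def s3_def s2_def s1_def)
qed

lemma body_code_simps:
  "v < n \<Longrightarrow> body_code n d (3*v) = 2" "v < n \<Longrightarrow> body_code n d (3*v+1) = 1"
  "v < n \<Longrightarrow> body_code n d (3*v+2) = 1"
  "i < d \<Longrightarrow> body_code n d (3*n+i) = 1"
  "body_code n d (3*n+d) = 2" "body_code n d (3*n+d+1) = 1"
  unfolding body_code_def by (auto; presburger)+


lemma wp_init_loop:
  assumes I: "init_loop_inv n d f s" and d: "d \<ge> 1" and k: "s ''k'' 0 = 0"
  shows "wp (While (Less (var ''row'') (var ''n'')) init_step)
    (\<lambda>s' t'. init_loop_inv n d f s' \<and> s' ''k'' 0 = n*d \<and> s' ''i'' 0 = 0 \<and> t' \<le> t + 11 * (n*d) + 1) s t"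
proof (rule wp_While[where \<mu> = "\<lambda>s. n*d - s ''k'' 0" and
    I = "\<lambda>s' t'. init_loop_inv n d f s' \<and> t' + 11 * (n*d - s' ''k'' 0) \<le> t + 11 * (n*d)"], goal_cases)
  case 1
  from I show ?case by simp
next
  case (2 u t1)
  then have I: "init_loop_inv n d f u" and row: "u ''row'' 0 < n" by (auto simp: init_loop_inv_def)
  have "u ''k'' 0 < (u ''row'' 0 + 1) * d" using I by (simp add: init_loop_inv_def)
  also have "\<dots> \<le> n * d" using row by (intro mult_le_mono1) simp
  finally have kN: "u ''k'' 0 < n*d" .
  from wp_init_step[OF I row] show ?case
    by (rule wp_mono) (use kN 2 in auto)
next
  case (3 u t1)
  then have I: "init_loop_inv n d f u" and row: "u ''row'' 0 = n" by (auto simp: init_loop_inv_def)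
  then have "u ''i'' 0 = 0" "u ''k'' 0 = n * d" by (simp_all add: init_loop_inv_def)
  with 3 I show ?case by simp
qed

definition same_state :: "store \<Rightarrow> store \<Rightarrow> bool" where
  "same_state s s' \<longleftrightarrow> (\<forall>x\<in>{''N'', ''n'', ''d'', ''var'', ''val'', ''atom'', ''count'', ''sum'', ''queue'',
     ''tail'', ''head'', ''conflict''}. s' x = s x)"

lemma wp_body_loop:
  assumes "s ''n'' 0 = n" "s ''row'' 0 = 0" "s ''j'' 0 = 0"
  shows "wp (While (Less (var ''row'') (var ''n'')) body_step)
    (\<lambda>s' t'. same_state s s' \<and> s' ''i'' = s ''i'' \<and> s' ''j'' 0 = 3*n \<and>
       (\<forall>j<3*n. s' ''body'' j = body_code n d j) \<and> t' \<le> t + 6 * n + 1) s t"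
proof (rule wp_While[where \<mu> = "\<lambda>s. n - s ''row'' 0" and
    I = "\<lambda>s' t'. same_state s s' \<and> s' ''i'' = s ''i'' \<and> s' ''row'' 0 \<le> n \<and> s' ''j'' 0 = 3 * s' ''row'' 0 \<and>
       (\<forall>j<3 * s' ''row'' 0. s' ''body'' j = body_code n d j) \<and> t' + 6 * (n - s' ''row'' 0) \<le> t + 6 * n"], goal_cases)
  case 1
  from assms show ?case by (simp add: same_state_def)
next
  case (2 u t1)
  let ?r = "u ''row'' 0"
  have r: "?r < n" "u ''j'' 0 = 3 * ?r" using 2 assms(1) by (auto simp: same_state_def)
  have *: "j < 3 * ?r \<or> j = 3 * ?r \<or> j = 3 * ?r + 1 \<or> j = 3 * ?r + 2" if "j < 3 + 3 * ?r" for j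
    using that by linarith
  note b = body_code_simps(1-3)[OF r(1), of d]
  define w where "w = put (put (put (put (put u ''body'' (3 * ?r) 2) ''body'' (3 * ?r + 1) 1) ''body'' (3 * ?r + 2) 1)
    ''j'' 0 (3 * ?r + 3)) ''row'' 0 (?r + 1)"
  have "w ''body'' j = body_code n d j" if "j < 3 * (?r + 1)" for j
    using *[of j] that b 2(1) by (auto simp: w_def)
  moreover have "w ''row'' 0 = ?r + 1" "w ''j'' 0 = 3 * (?r + 1)" "same_state s w" "w ''i'' = s ''i''"
    using 2(1) by (auto simp: w_def same_state_def)
  moreover have "wp body_step Q u (t1 + 1) = Q w (t1 + 6)" for Q
    using r(2) by (simp add: body_step_def w_def eval_nat_numeral)
  ultimately show ?case using 2(1) r(1) by auto
next
  case (3 u t1)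
  then have "u ''row'' 0 = n" using assms(1) by (auto simp: same_state_def)
  with 3 show ?case by simp
qed

lemma wp_column_body_loop:
  assumes "s ''d'' 0 = d" "s ''i'' 0 = 0" "s ''j'' 0 = 3*n" "\<forall>j<3*n. s ''body'' j = body_code n d j"
  shows "wp (While (Less (var ''i'') (var ''d'')) column_body_step)
    (\<lambda>s' t'. same_state s s' \<and> s' ''j'' 0 = 3*n + d \<and>
       (\<forall>j<3*n + d. s' ''body'' j = body_code n d j) \<and> t' \<le> t + 4 * d + 1) s t"
proof (rule wp_While[where \<mu> = "\<lambda>s. d - s ''i'' 0" and
    I = "\<lambda>s' t'. same_state s s' \<and> s' ''i'' 0 \<le> d \<and> s' ''j'' 0 = 3*n + s' ''i'' 0 \<and>
       (\<forall>j<3*n + s' ''i'' 0. s' ''body'' j = body_code n d j) \<and> t' + 4 * (d - s' ''i'' 0) \<le> t + 4 * d"], goal_cases)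
  case 1
  from assms show ?case by (simp add: same_state_def)
next
  case (2 u t1)
  have r: "u ''i'' 0 < d" using 2 assms(1) by (auto simp: same_state_def)
  with 2(1) body_code_simps(4)[OF r, of n] show ?case
    by (auto simp: column_body_step_def same_state_def less_Suc_eq)
next
  case (3 u t1)
  then have "u ''i'' 0 = d" using assms(1) by (auto simp: same_state_def)
  with 3 show ?case by simp
qed

text \<open>A row with a singleton initial domain has one candidate before anything is falsified.
  This pass makes that cell true and extends the set of checked rows from \<open>{}\<close> to all
  rows.\<close>

lemma wp_check_loop:
  assumes "state_inv n d T {} h s" "s ''n'' 0 = n" "s ''row'' 0 = 0" "s ''head'' 0 = h"
  shows "wp (While (Less (var ''row'') (var ''n'')) check_step)
    (\<lambda>s' t'. state_inv n d T {..<n} h s' \<and> extends s s' \<and> s' ''head'' 0 = h \<and> t' \<le> t + 6 * n + 1) s t"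
proof (rule wp_While[where \<mu> = "\<lambda>s. n - s ''row'' 0" and
    I = "\<lambda>s' t'. state_inv n d T {..<s' ''row'' 0} h s' \<and> extends s s' \<and> keeps_locals s s' \<and>
      s' ''row'' 0 \<le> n \<and> t' + 6 * (n - s' ''row'' 0) \<le> t + 6 * n"], goal_cases)
  case 1
  from assms show ?case by (simp add: keeps_locals_def)
next
  case (2 u t1)
  have n: "u ''row'' 0 < n" using 2 assms(2) by (auto simp: keeps_locals_def)
  have "wp check (wp (assign ''row'' (Plus (var ''row'') (Const 1)))
     (\<lambda>s' t'. (state_inv n d T {..<s' ''row'' 0} h s' \<and> extends s s' \<and> keeps_locals s s' \<and>
      s' ''row'' 0 \<le> n \<and> t' + 6 * (n - s' ''row'' 0) \<le> t + 6 * n) \<and> n - s' ''row'' 0 < n - u ''row'' 0)) u (t1 + 1)"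
  proof (rule wp_mono[OF wp_check[OF conjunct1[OF 2(1)] n]], goal_cases)
    case (1 s' t')
    have e: "extends s s'" using 1 2(1) by (blast intro: extends_trans)
    have row: "s' ''row'' 0 = u ''row'' 0" using 1 by simp
    have "insert (u ''row'' 0) {..<u ''row'' 0} = {..<u ''row'' 0 + 1}" by auto
    with 1 have I: "state_inv n d T {..<u ''row'' 0 + 1} h s'" by simp
    define w where "w = put s' ''row'' 0 (u ''row'' 0 + 1)"
    have w: "state_inv n d T {..<u ''row'' 0 + 1} h w" "extends s w" "w ''row'' 0 = u ''row'' 0 + 1"
      using I e by (simp_all add: state_inv_def extends_def w_def)
    moreover have "keeps_locals s w" using 1 2(1) by (simp add: keeps_locals_def w_def)
    moreover have "t' + 1 + 6 * (n - (u ''row'' 0 + 1)) \<le> t + 6 * n" using n 1 2(1) by auto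
    ultimately show ?case using n by (simp add: row w_def diff_less_mono2)
  qed
  then show ?case by (simp add: check_step_def)
next
  case (3 u t1)
  then have "u ''row'' 0 = n" using assms(2) by (auto simp: keeps_locals_def)
  with 3 assms(4) show ?case by (simp add: keeps_locals_def)
qed

text \<open>Nonempty domains give every row a candidate, so the clear flag is consistent. Soundness
  is immediate because the array is the start grid itself.\<close>

lemma init_prop_inv:
  assumes "\<forall>v<n. \<exists>k<n*d. k div d = v \<and> f k = 1"
  shows "prop_inv n d (dom_codes f) {} (dom_codes f) (\<lambda>v. card (candidates n d (dom_codes f) v))
    (\<lambda>v. \<Sum>(candidates n d (dom_codes f) v)) q 0 0 0"
proof -
  have "candidates n d (dom_codes f) v \<noteq> {}" if "v < n" for v
  proof -
    from assms that obtain k where "k < n*d" "k div d = v" "f k = 1" by blast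
    then have "k \<in> candidates n d (dom_codes f) v" by (simp add: candidates_def dom_codes_def)
    then show ?thesis by blast
  qed
  moreover have "dom_codes f k \<noteq> 2" "dom_codes f k \<le> 2" for k by (simp_all add: dom_codes_def)
  ultimately show ?thesis by (simp add: prop_inv_def closed_above_def)
qed

lemma prop_inv_cong_counts:
  assumes "prop_inv n d T R a c m q e h cf" "\<And>v. v < n \<Longrightarrow> c' v = c v \<and> m' v = m v"
  shows "prop_inv n d T R a c' m' q e h cf"
  using assms unfolding prop_inv_def by auto

lemma wp_start:
  assumes s: "s ''n'' 0 = n" "s ''d'' 0 = d" "s ''dom'' = f"
    "\<And>x. x \<notin> {''n'', ''d'', ''dom''} \<Longrightarrow> s x = (\<lambda>_. 0)"
    and n: "n \<ge> 1" and d: "d \<ge> 1" and dom: "\<forall>v<n. \<exists>k<n*d. k div d = v \<and> f k = 1"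
  shows "wp start (\<lambda>s' t'. finished n d (dom_codes f) s' \<and> t' + credit n d s' \<le>
     11 * (n*d) + 12 * n + 4 * d + 15 + (14 * (n*d) + 5) * d) s 0"
proof -
  let ?N = "n*d" and ?T = "dom_codes f"
  define F where "F s' t' \<longleftrightarrow> finished n d (dom_codes f) s' \<and> t' + credit n d s' \<le>
     11 * (n*d) + 12 * n + 4 * d + 15 + (14 * (n*d) + 5) * d" for s' t'
  have C: "{k. k < ?N \<and> k div d = v \<and> ?T k \<noteq> 1} = candidates n d ?T v" for v
    by (simp add: candidates_def)
  \<comment> \<open>Verification runs from the back: \<open>final\<close> and \<open>bodies\<close>
    treat the later stretches for arbitrary stores. The body loop and the check loop cost
    \<open>6 * n\<close> each, whence \<open>12 * n\<close>.\<close>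
  have final: "wp (While (Less (var ''row'') (var ''n'')) check_step) (wp propagate F) u t"
    if u: "state_inv n d ?T {} 0 u" "tables n d u" "fixed_values n d u" "u ''n'' 0 = n" "u ''row'' 0 = 0"
      "u ''head'' 0 = 0" "codes_le n d ?T (u ''atom'')" "t \<le> 11 * ?N + 6 * n + 4 * d + 12" for u t
  proof (rule wp_mono[OF wp_check_loop[OF u(1,4,5,6)]], goal_cases)
    case (1 w t')
    then have e: "extends u w" and I: "state_inv n d ?T {..<n} (w ''head'' 0) w" by simp_all
    show ?case
    proof (rule wp_mono[OF wp_propagate[OF I _ _ _ d]], goal_cases)
      case (4 s' t'')
      have "credit n d w = (14 * ?N + 5) * d" using 1 by (simp add: credit_def)
      with 4 1 u(8) show ?case by (simp add: F_def)
    qed (use extends_tables[OF e u(2)] extends_fixed_values[OF e u(3)] extends_codes_le[OF e u(7)] in auto)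
  qed
  have bodies: "wp (assign ''row'' (Const 0)) (wp (While (Less (var ''row'') (var ''n'')) body_step)
      (wp (While (Less (var ''i'') (var ''d'')) column_body_step)
      (wp (Put ''body'' (var ''j'') (Const 2) ;; Put ''body'' (Plus (var ''j'') (Const 1)) (Const 1) ;;
           assign ''row'' (Const 0)) (wp (While (Less (var ''row'') (var ''n'')) check_step) (wp propagate F))))) u t"
    if u: "state_inv n d ?T {} 0 u" "tables n d u" "u ''n'' 0 = n" "u ''d'' 0 = d" "u ''i'' 0 = 0" "u ''j'' 0 = 0"
      "u ''head'' 0 = 0" "codes_le n d ?T (u ''atom'')" "u ''atom'' ?N = 1" "u ''atom'' (?N + 1) = 2"
      "u ''atom'' (?N + 2) = 1" "t \<le> 11 * ?N + 5" for u t
    unfolding wp_Put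
  proof (rule wp_mono[OF wp_body_loop[where n = n and d = d]], goal_cases)
    case (4 w t1)
    have w: "same_state u w" using 4 by (simp add: same_state_def)
    show ?case
    proof (rule wp_mono[OF wp_column_body_loop[where n = n and d = d]], goal_cases)
      case (5 x t2)
      have x: "same_state u x" using 5 w by (simp add: same_state_def)
      define y where "y = put (put (put x ''body'' (3*n + d) 2) ''body'' (3*n + d + 1) 1) ''row'' 0 0"
      have y: "same_state u y" using x by (simp add: same_state_def y_def)
      have b: "y ''body'' j = body_code n d j" if "j < 3*n + d + 2" for j
      proof -
        from that consider "j < 3*n + d" | "j = 3*n + d" | "j = 3*n + d + 1" by linarith
        then show ?thesis using 5 body_code_simps(5,6)[of n d] by cases (auto simp: y_def)
      qed
      have "fixed_values n d y" using u(9-11) y b by (simp add: fixed_values_def same_state_def)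
      moreover have "state_inv n d ?T {} 0 y" "tables n d y" "y ''n'' 0 = n" "y ''row'' 0 = 0" "y ''head'' 0 = 0"
        "codes_le n d ?T (y ''atom'')"
        using u y by (simp_all add: state_inv_def tables_def same_state_def y_def)
      ultimately have "wp (While (Less (var ''row'') (var ''n'')) check_step) (wp propagate F) y (t2 + 1 + 1 + 1)"
        using 4 5 u(12) by (intro final) auto
      moreover have "x ''j'' 0 = 3*n + d" using 5 by simp
      ultimately show ?case by (simp add: y_def)
    qed (use u w 4 in \<open>auto simp: same_state_def\<close>)
  qed (use u in \<open>auto simp: same_state_def\<close>)
  have init: "init_loop_inv n d f s" "s ''k'' 0 = 0"
    using s n d by (simp_all add: init_loop_inv_def)
  have "wp (While (Less (var ''row'') (var ''n'')) init_step)
    (wp (assign ''N'' (var ''k'') ;; Put ''atom'' (var ''N'') (Const 1) ;;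
     Put ''atom'' (Plus (var ''N'') (Const 1)) (Const 2) ;; Put ''atom'' (Plus (var ''N'') (Const 2)) (Const 1))
    (wp (assign ''row'' (Const 0)) (wp (While (Less (var ''row'') (var ''n'')) body_step)
      (wp (While (Less (var ''i'') (var ''d'')) column_body_step)
      (wp (Put ''body'' (var ''j'') (Const 2) ;; Put ''body'' (Plus (var ''j'') (Const 1)) (Const 1) ;;
           assign ''row'' (Const 0)) (wp (While (Less (var ''row'') (var ''n'')) check_step) (wp propagate F))))))) s 0"
  proof (rule wp_mono[OF wp_init_loop[OF init(1) d init(2)]], goal_cases)
    case (1 u t)
    define w where "w = put (put (put (put u ''N'' 0 ?N) ''atom'' ?N 1) ''atom'' (?N + 1) 2) ''atom'' (?N + 2) 1"
    have I: "init_loop_inv n d f u" and k: "u ''k'' 0 = ?N" "u ''i'' 0 = 0" using 1 by simp_all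
    have atom: "w ''atom'' k = ?T k" if "k < ?N" for k
      using I k that by (simp add: w_def init_loop_inv_def)
    have "prop_inv n d ?T {} (w ''atom'') (u ''count'') (u ''sum'') (u ''queue'') 0 0 0"
    proof (rule prop_inv_cong_counts[OF prop_inv_cong[OF init_prop_inv[OF dom]]])
      show "w ''atom'' k = ?T k" if "k < ?N" for k using atom[OF that] .
      show "u ''count'' v = card (candidates n d ?T v) \<and> u ''sum'' v = \<Sum>(candidates n d ?T v)" for v
        using I k unfolding init_loop_inv_def C[symmetric] by simp
    qed
    moreover have "w ''tail'' 0 = 0" "w ''conflict'' 0 = 0"
      using I by (simp_all add: w_def init_loop_inv_def)
    moreover have "w ''count'' = u ''count''" "w ''sum'' = u ''sum''" "w ''queue'' = u ''queue''"
      by (simp_all add: w_def)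
    ultimately have "state_inv n d ?T {} 0 w" by (simp add: state_inv_def)
    moreover have "tables n d w" "w ''n'' 0 = n" "w ''d'' 0 = d" "w ''i'' 0 = 0" "w ''j'' 0 = 0" "w ''head'' 0 = 0"
      "w ''atom'' ?N = 1" "w ''atom'' (?N + 1) = 2" "w ''atom'' (?N + 2) = 1"
      using I k by (simp_all add: tables_def init_loop_inv_def w_def)
    moreover have "codes_le n d ?T (w ''atom'')" using atom by (simp add: codes_le_def)
    moreover have "t + 1 + 1 + 1 + 1 \<le> 11 * ?N + 5" using 1 by simp
    ultimately have "wp (assign ''row'' (Const 0)) (wp (While (Less (var ''row'') (var ''n'')) body_step)
      (wp (While (Less (var ''i'') (var ''d'')) column_body_step)
      (wp (Put ''body'' (var ''j'') (Const 2) ;; Put ''body'' (Plus (var ''j'') (Const 1)) (Const 1) ;;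
           assign ''row'' (Const 0)) (wp (While (Less (var ''row'') (var ''n'')) check_step) (wp propagate F)))))
      w (t + 1 + 1 + 1 + 1)"
      by (intro bodies)
    with k show ?case by (simp add: w_def)
  qed
  then show ?thesis
    unfolding start_def wp_Seq F_def[abs_def] .
qed

section \<open>Correctness of the implementation\<close>

lemma cell_index:
  fixes n d v i :: nat
  assumes "v \<in> {1..n}" "i \<in> {1..d}"
  shows "(v - 1) * d + (i - 1) < n * d" "((v - 1) * d + (i - 1)) div d = v - 1"
    "((v - 1) * d + (i - 1)) mod d = i - 1"
proof -
  have "(v - 1) * d + (i - 1) < (v - 1) * d + d" by (intro add_strict_left_mono) (use assms in auto)
  also have "\<dots> = v * d" using assms by (cases v) auto
  also have "\<dots> \<le> n * d" using assms by simp
  finally show "(v - 1) * d + (i - 1) < n * d" .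
  have "(q * d + r) div d = q" "(q * d + r) mod d = r" if "r < d" for q r
    using that by simp_all
  moreover have "i - 1 < d" using assms by auto
  ultimately show "((v - 1) * d + (i - 1)) div d = v - 1" "((v - 1) * d + (i - 1)) mod d = i - 1"
    by blast+
qed

lemma index_cell:
  assumes "k < n * (d::nat)"
  shows "k div d + 1 \<in> {1..n}" "k mod d + 1 \<in> {1..d}" "(k div d + 1 - 1) * d + (k mod d + 1 - 1) = k"
proof -
  have "d > 0" using assms by (cases d) auto
  then show "k div d + 1 \<in> {1..n}" "k mod d + 1 \<in> {1..d}" "(k div d + 1 - 1) * d + (k mod d + 1 - 1) = k"
    using div_less_rows[OF assms] by (auto simp: Suc_le_eq)
qed

section \<open>Translation between grids and code arrays\<close>

definition grid_codes :: "nat \<Rightarrow> (nat \<Rightarrow> nat \<Rightarrow> bool option) \<Rightarrow> nat \<Rightarrow> nat" where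
  "grid_codes d S k = encode (S (k div d + 1) (k mod d + 1))"

definition codes_grid :: "nat \<Rightarrow> (nat \<Rightarrow> nat) \<Rightarrow> nat \<Rightarrow> nat \<Rightarrow> bool option" where
  "codes_grid d a v i = (let x = a ((v - 1) * d + (i - 1)) in if x = 0 then None else Some (x = 2))"

lemma encode_eq [simp]:
  "encode x = 0 \<longleftrightarrow> x = None" "encode x = Suc 0 \<longleftrightarrow> x = Some False" "encode x = 2 \<longleftrightarrow> x = Some True" "encode x \<le> 2"
  by (cases x rule: encode.cases; simp)+

lemma closed_grid_codes:
  assumes "closed n d S"
  shows "closed_codes n d (grid_codes d S)"
  unfolding closed_codes_def
proof (intro conjI allI impI)
  fix k l assume k: "k < n*d" "l < n*d" "grid_codes d S k = 2" "related d l k"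
  note c = index_cell[OF k(1)] index_cell[OF k(2)]
  \<comment> \<open>Distinct indices differ in quotient or remainder, so cells related through one
    coordinate differ in the other.\<close>
  have ne: "k div d \<noteq> l div d \<or> k mod d \<noteq> l mod d" using k(4) unfolding related_def by (metis div_mult_mod_eq)
  have S: "S (k div d + 1) (k mod d + 1) = Some True" using k(3) by (simp add: grid_codes_def)
  from k(4) consider "k div d = l div d" | "k mod d = l mod d" by (auto simp: related_def)
  then have "S (l div d + 1) (l mod d + 1) = Some False"
  proof cases
    case 1
    then show ?thesis using closedD_row[OF assms c(1,2,5) _ S] ne by auto
  next
    case 2
    then show ?thesis using closedD_col[OF assms c(1,2,4) _ S] ne by auto
  qed
  then show "grid_codes d S l = 1" by (simp add: grid_codes_def)
next
  fix k assume k: "k < n*d" "\<forall>l<n*d. l \<noteq> k \<longrightarrow> l div d = k div d \<longrightarrow> grid_codes d S l = 1"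
  note c = index_cell[OF k(1)]
  have "S (k div d + 1) j = Some False" if j: "j \<in> {1..d}" "j \<noteq> k mod d + 1" for j
  proof -
    let ?l = "(k div d + 1 - 1) * d + (j - 1)"
    note l = cell_index[OF c(1) j(1)]
    have "?l \<noteq> k"
    proof
      assume "?l = k"
      then have "k mod d = j - 1" using l(3) by simp
      with j show False by auto
    qed
    with k(2) l have "grid_codes d S ?l = 1" by simp
    then show ?thesis using l j by (simp add: grid_codes_def)
  qed
  with assms c(1,2) have "S (k div d + 1) (k mod d + 1) = Some True" unfolding closed_def by blast
  then show "grid_codes d S k = 2" by (simp add: grid_codes_def)
qed (simp add: grid_codes_def)

lemma closed_codes_grid:
  assumes "closed_codes n d a"
  shows "closed n d (codes_grid d a)"
  unfolding closed_def
proof (intro ballI conjI impI)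
  fix v i j assume *: "v \<in> {1..n}" "i \<in> {1..d}" "codes_grid d a v i = Some True" "j \<in> {1..d}" "j \<noteq> i"
  let ?k = "(v - 1) * d + (i - 1)" and ?l = "(v - 1) * d + (j - 1)"
  note k = cell_index[OF *(1,2)] and l = cell_index[OF *(1,4)]
  have "related d ?l ?k" unfolding related_def k l using *(2,4,5) by auto
  moreover have "a ?k = 2" using *(3) by (auto simp: codes_grid_def Let_def split: if_splits)
  ultimately have "a ?l = 1" using assms k(1) l(1) unfolding closed_codes_def by blast
  then show "codes_grid d a v j = Some False" by (simp add: codes_grid_def)
next
  fix v i w assume *: "v \<in> {1..n}" "i \<in> {1..d}" "codes_grid d a v i = Some True" "w \<in> {1..n}" "w \<noteq> v"
  let ?k = "(v - 1) * d + (i - 1)" and ?l = "(w - 1) * d + (i - 1)"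
  note k = cell_index[OF *(1,2)] and l = cell_index[OF *(4,2)]
  have "v - 1 \<noteq> w - 1" using *(1,4,5) by auto
  then have "?l \<noteq> ?k" using k(2) l(2) by metis
  then have "related d ?l ?k" unfolding related_def k l by simp
  moreover have "a ?k = 2" using *(3) by (auto simp: codes_grid_def Let_def split: if_splits)
  ultimately have "a ?l = 1" using assms k(1) l(1) unfolding closed_codes_def by blast
  then show "codes_grid d a w i = Some False" by (simp add: codes_grid_def)
next
  fix v i assume *: "v \<in> {1..n}" "i \<in> {1..d}" "\<forall>j\<in>{1..d}. j \<noteq> i \<longrightarrow> codes_grid d a v j = Some False"
  let ?k = "(v - 1) * d + (i - 1)"
  note k = cell_index[OF *(1,2)]
  have "a l = 1" if l: "l < n*d" "l \<noteq> ?k" "l div d = ?k div d" for l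
  proof -
    note c = index_cell[OF l(1)]
    have v: "l div d + 1 = v" using l(3) k(2) *(1) by simp
    then have ne: "l mod d + 1 \<noteq> i" using c(3) l(2) by auto
    have "codes_grid d a v (l mod d + 1) = Some False" using *(3) c(2) ne by blast
    then have f: "codes_grid d a (l div d + 1) (l mod d + 1) = Some False" by (simp only: v)
    then have "a l \<noteq> 0" "a l \<noteq> 2" by (auto simp: codes_grid_def Let_def split: if_splits)
    moreover have "a l \<le> 2" using assms l(1) unfolding closed_codes_def by blast
    ultimately show ?thesis by linarith
  qed
  then have "a ?k = 2" using assms k(1) unfolding closed_codes_def by blast
  then show "codes_grid d a v i = Some True" by (simp add: codes_grid_def)
qed

lemma grid_le_codes:
  assumes "grid_le n d T S"
  shows "codes_le n d (grid_codes d T) (grid_codes d S)"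
  unfolding codes_le_def
proof (intro allI impI)
  fix k assume k: "k < n*d" "grid_codes d T k \<noteq> 0"
  then have "T (k div d + 1) (k mod d + 1) \<noteq> None" by (simp add: grid_codes_def)
  with assms index_cell(1,2)[OF k(1)] have "S (k div d + 1) (k mod d + 1) = T (k div d + 1) (k mod d + 1)"
    unfolding grid_le_def by blast
  then show "grid_codes d S k = grid_codes d T k" by (simp only: grid_codes_def)
qed

lemma grid_codes_cell:
  "v \<in> {1..n} \<Longrightarrow> i \<in> {1..d} \<Longrightarrow> grid_codes d S ((v - 1) * d + (i - 1)) = encode (S v i)"
  using cell_index(2,3)[of v n i d] by (simp add: grid_codes_def)

lemma codes_grid_grid_codes:
  "v \<in> {1..n} \<Longrightarrow> i \<in> {1..d} \<Longrightarrow> codes_grid d (grid_codes d S) v i = S v i"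
  by (cases "S v i" rule: encode.cases) (simp_all only: codes_grid_def grid_codes_cell, simp_all)

lemma grid_le_codes_grid:
  "grid_le n d (codes_grid d (grid_codes d T)) S \<longleftrightarrow> grid_le n d T S"
  "grid_le n d S (codes_grid d (grid_codes d T)) \<longleftrightarrow> grid_le n d S T"
  unfolding grid_le_def by (intro ball_cong refl; simp only: codes_grid_grid_codes)+

lemma codes_le_grid:
  assumes "codes_le n d a b"
  shows "grid_le n d (codes_grid d a) (codes_grid d b)"
  unfolding grid_le_def
proof (intro ballI impI)
  fix v i assume *: "v \<in> {1..n}" "i \<in> {1..d}" "codes_grid d a v i \<noteq> None"
  let ?k = "(v - 1) * d + (i - 1)"
  have "a ?k \<noteq> 0" using *(3) by (auto simp: codes_grid_def Let_def split: if_splits)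
  with assms cell_index(1)[OF *(1,2)] have "b ?k = a ?k" unfolding codes_le_def by blast
  then show "codes_grid d b v i = codes_grid d a v i" by (simp only: codes_grid_def)
qed

section \<open>Positions of the rules and values of their bodies\<close>

lemma length_concat_triples: "length (concat (map (\<lambda>v. [x v, y v, z v]) [1..<n + 1])) = 3 * n"
  by (induction n) auto

lemma nth_concat_triples:
  "j < 3 * n \<Longrightarrow> concat (map (\<lambda>v. [x v, y v, z v]) [1..<n + 1]) ! j =
     (if j mod 3 = 0 then x (j div 3 + 1) else if j mod 3 = 1 then y (j div 3 + 1) else z (j div 3 + 1))"
proof (induction n)
  case (Suc n)
  have app: "concat (map (\<lambda>v. [x v, y v, z v]) [1..<Suc n + 1]) =
    concat (map (\<lambda>v. [x v, y v, z v]) [1..<n + 1]) @ [x (n + 1), y (n + 1), z (n + 1)]" by simp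
  have dm: "Suc (3 * n) div 3 = n" "Suc (Suc (3 * n)) div 3 = n" "Suc (3 * n) mod 3 = 1" "Suc (Suc (3 * n)) mod 3 = 2"
    by presburger+
  from Suc.prems have "j < 3 * n \<or> j = 3 * n \<or> j = 3 * n + 1 \<or> j = 3 * n + 2" by presburger
  then consider "j < 3 * n" | "j = 3 * n" | "j = 3 * n + 1" | "j = 3 * n + 2" by blast
  then show ?case
    unfolding app nth_append length_concat_triples
    by cases (use Suc.IH in \<open>auto simp: dm\<close>)
qed simp

lemma length_alldiff_program: "length (alldiff_program n d) = 3 * n + d + 2"
  unfolding alldiff_program_def length_append length_concat_triples length_map length_upt by simp

lemma alldiff_body_code:
  assumes d: "d \<ge> 1" and j: "j < length (alldiff_program n d)"
  shows "body_code n d j = encode (completion n d S (Body (body_of (alldiff_program n d ! j))))"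
proof -
  let ?P = "alldiff_program n d"
  have c: "completion n d S (Body (body_of (?P ! j))) =
      Some (body_of (?P ! j) = Conj {} \<or> body_of (?P ! j) = Conj {Neg Violate})"
    using nth_mem[OF j] by (simp add: completion_def)
  \<comment> \<open>Because \<open>d \<ge> 1\<close>, the at-least bodies differ from the two true
    bodies.\<close>
  have ne: "(\<lambda>i. Neg (E v i)) ` {1..d} \<noteq> {}" "(\<lambda>i. Neg (E v i)) ` {1..d} \<noteq> {Neg Violate}" for v
    using d by auto
  note P = alldiff_program_def[of n d] nth_append length_append length_concat_triples length_map
  from j have "j < 3*n + d + 2" by (simp only: length_alldiff_program)
  then have "j < 3*n \<or> 3*n \<le> j \<and> j - 3*n < d \<or> j = 3*n + d \<or> j = 3*n + d + 1" by linarith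
  then consider "j < 3*n" | "3*n \<le> j" "j - 3*n < d" | "j = 3*n + d" | "j = 3*n + d + 1" by blast
  then show ?thesis
  proof cases
    case 1
    then show ?thesis unfolding c unfolding P nth_concat_triples[OF 1] using ne by (simp add: body_code_def)
  next
    case 2
    then show ?thesis unfolding c unfolding P by (simp add: body_code_def del: upt_Suc)
  next
    case 3
    then show ?thesis unfolding c unfolding P by (simp add: body_code_def del: upt_Suc)
  next
    case 4
    then show ?thesis unfolding c unfolding P by (simp add: body_code_def del: upt_Suc)
  qed
qed

text \<open>Links program and propagation. A conflict-free fixpoint is a closed grid above
  \<open>T\<close>, so by soundness the flag is clear and the array lies below it. Conversely, a
  clear flag makes the array a closed grid above the start, so the fixpoint has no conflict and lies
  below the array. The two bounds give equality.\<close>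

lemma finished_represents:
  assumes fin: "finished n d T s" and T: "\<And>k. k < n*d \<Longrightarrow> T k = grid_codes d G k" and d: "d \<ge> 1"
    and fp: "up_fixpoint (nogoods (alldiff_program n d)) A0 A" and st: "starts n d G A0"
  shows "represents n d (alldiff_program n d) s A"
    and "\<not> conflict (nogoods (alldiff_program n d)) A \<Longrightarrow>
       s ''conflict'' 0 = 0 \<and> A = completion n d (codes_grid d (s ''atom''))"
proof -
  let ?P = "alldiff_program n d" and ?a = "s ''atom''"
  have d': "n = 0 \<or> d \<ge> 1" using d by simp
  have above: "closed_above n d T = closed_above n d (grid_codes d G)"
    using T by (simp add: closed_above_def codes_le_def)
  have I: "prop_inv n d T {..<n} ?a (s ''count'') (s ''sum'') (s ''queue'') (s ''tail'' 0) (s ''head'' 0) (s ''conflict'' 0)"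
    using fin by (simp add: finished_def state_inv_def)
  have le2: "?a k \<le> 2" if "k < n*d" for k using I that by (simp add: prop_inv_def)
  have noconf: "s ''conflict'' 0 = 0 \<and> A = completion n d (codes_grid d ?a)"
    if "\<not> conflict (nogoods ?P) A"
  proof -
    from fp st d' that obtain S where S: "closed n d S" "grid_le n d G S" "A = completion n d S"
      by (rule fixpoint_no_conflict)
    have "grid_codes d S \<in> closed_above n d T"
      unfolding above unfolding closed_above_def using closed_grid_codes[OF S(1)] grid_le_codes[OF S(2)] by simp
    from prop_inv_sound[OF I this] have cf: "s ''conflict'' 0 = 0" and le: "codes_le n d ?a (grid_codes d S)" .
    have cl: "closed_codes n d ?a"
      using prop_inv_closed[of n d T "{..<n}" ?a] I fin cf by (simp add: finished_def)
    have "codes_le n d (grid_codes d G) ?a" using fin T by (simp add: finished_def codes_le_def)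
    from codes_le_grid[OF this] have "grid_le n d G (codes_grid d ?a)"
      by (simp only: grid_le_codes_grid)
    from fixpoint_below_closed(2)[OF fp st d' closed_codes_grid[OF cl] this]
    have "A \<subseteq>\<^sub>m completion n d (codes_grid d ?a)" .
    moreover from codes_le_grid[OF le] have "grid_le n d (codes_grid d ?a) S"
      by (simp only: grid_le_codes_grid)
    then have "completion n d (codes_grid d ?a) \<subseteq>\<^sub>m A" unfolding S(3) by (rule completion_mono)
    ultimately show ?thesis using cf by (blast intro: map_le_antisym)
  qed
  then show "\<not> conflict (nogoods ?P) A \<Longrightarrow> s ''conflict'' 0 = 0 \<and> A = completion n d (codes_grid d ?a)" .
  have conf: "\<not> conflict (nogoods ?P) A" if "s ''conflict'' 0 = 0"
  proof -
    have cl: "closed_codes n d ?a"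
      using prop_inv_closed[of n d T "{..<n}" ?a] I fin that by (simp add: finished_def)
    have "codes_le n d (grid_codes d G) ?a" using fin T by (simp add: finished_def codes_le_def)
    from codes_le_grid[OF this] have "grid_le n d G (codes_grid d ?a)"
      by (simp only: grid_le_codes_grid)
    from fixpoint_below_closed(1)[OF fp st d' closed_codes_grid[OF cl] this] show ?thesis .
  qed
  have fixed: "fixed_values n d s" using fin by (simp add: finished_def)
  have atom: "?a (atom_index n d x) = encode (completion n d (codes_grid d ?a) (Atom x))" if "x \<in> atoms ?P" for x
    using that
  proof (cases rule: atoms_alldiff_program)
    case (4 v i)
    then have "?a ((v - 1) * d + (i - 1)) \<le> 2" using le2 cell_index(1) by blast
    then consider "?a ((v - 1) * d + (i - 1)) = 0" | "?a ((v - 1) * d + (i - 1)) = 1" | "?a ((v - 1) * d + (i - 1)) = 2"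
      by linarith
    then have "?a ((v - 1) * d + (i - 1)) = encode (codes_grid d ?a v i)"
      by cases (simp_all add: codes_grid_def)
    with 4 show ?thesis by simp
  qed (use fixed in \<open>simp_all add: fixed_values_def\<close>)
  have body: "s ''body'' j = encode (completion n d (codes_grid d ?a) (Body (body_of (?P ! j))))"
    if "j < length ?P" for j
    using that fixed alldiff_body_code[OF d that] by (simp add: fixed_values_def length_alldiff_program)
  show "represents n d ?P s A"
    unfolding represents_def using noconf conf atom body by metis
qed


section \<open>Sessions along a branch\<close>

lemma input_store_simps:
  "input_store n d D ''n'' 0 = n" "input_store n d D ''d'' 0 = d"
  "x \<notin> {''n'', ''d'', ''dom''} \<Longrightarrow> input_store n d D x = (\<lambda>_. 0)"
  by (auto simp: input_store_def fun_eq_iff)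

lemma input_store_dom:
  assumes "k < n * d"
  shows "input_store n d D ''dom'' k = (if k mod d + 1 \<in> D (k div d + 1) then 1 else 0)"
proof -
  note c = index_cell[OF assms]
  have "(\<exists>v\<in>{1..n}. \<exists>i\<in>D v \<inter> {1..d}. k = atom_index n d (E v i)) \<longleftrightarrow> k mod d + 1 \<in> D (k div d + 1)"
    (is "?L \<longleftrightarrow> ?R")
  proof
    assume ?L
    then obtain v i where v: "v \<in> {1..n}" "i \<in> D v" "i \<in> {1..d}" "k = (v - 1) * d + (i - 1)" by auto
    from cell_index[OF v(1,3), folded v(4)] have "k div d + 1 = v" "k mod d + 1 = i" using v(1,3) by auto
    with v(2) show ?R by (simp only:)
  next
    assume ?R
    with c show ?L by (intro bexI[of _ "k div d + 1"] bexI[of _ "k mod d + 1"]) auto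
  qed
  then show ?thesis by (simp add: input_store_def)
qed

definition assigned_cells :: "nat \<Rightarrow> nat \<Rightarrow> assignment \<Rightarrow> (nat \<times> nat) set" where
  "assigned_cells n d A = {(v, i). v \<in> {1..n} \<and> i \<in> {1..d} \<and> A (Atom (E v i)) \<noteq> None}"

lemma finite_assigned_cells: "finite (assigned_cells n d A)"
  and card_assigned_cells: "card (assigned_cells n d A) \<le> n * d"
proof -
  have "assigned_cells n d A \<subseteq> {1..n} \<times> {1..d}" by (auto simp: assigned_cells_def)
  then show "finite (assigned_cells n d A)" "card (assigned_cells n d A) \<le> n * d"
    using finite_subset card_mono[of "{1..n} \<times> {1..d}" "assigned_cells n d A"] by (auto simp: card_cartesian_product)
qed

text \<open>\<open>T\<close> is existential because it changes with every decision. Keeping the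
  credit beside the time lets all calls share one supply of scans. The last conjunct bounds the
  number of decisions: each fills an unassigned cell, and propagation never removes a value.\<close>

lemma branch_session:
  assumes n: "n \<ge> 1" and d: "d \<ge> 1" and D: "initial_domains n d D"
    and "branch (alldiff_program n d) (initial_assignment n d D) ds A"
  shows "\<exists>s t T. session start resume n d D ds s t \<and> finished n d T s \<and>
    represents n d (alldiff_program n d) s A \<and>
    (\<not> conflict (nogoods (alldiff_program n d)) A \<longrightarrow>
       s ''conflict'' 0 = 0 \<and> A = completion n d (codes_grid d (s ''atom''))) \<and>
    t + credit n d s \<le> 11 * (n*d) + 12 * n + 4 * d + 15 + (14 * (n*d) + 5) * d + 13 * length ds \<and>
    length ds \<le> card (assigned_cells n d A)"
  using assms(4)
proof (induction rule: branch.induct)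
  case (root A)
  let ?f = "input_store n d D ''dom''"
  have dom: "\<forall>v<n. \<exists>k<n*d. k div d = v \<and> ?f k = 1"
  proof (intro allI impI)
    fix v assume "v < n"
    then have v: "v + 1 \<in> {1..n}" by simp
    with D obtain i where i: "i \<in> D (v + 1)" "i \<in> {1..d}" unfolding initial_domains_def by blast
    note c = cell_index[OF v i(2)]
    have "?f ((v + 1 - 1) * d + (i - 1)) = 1" using input_store_dom[OF c(1)] c i by simp
    with c show "\<exists>k<n*d. k div d = v \<and> ?f k = 1" by (metis add_diff_cancel_right')
  qed
  from wp_start[OF input_store_simps(1,2) refl input_store_simps(3) n d dom]
  obtain s t where s: "exec start (input_store n d D) t s" "finished n d (dom_codes ?f) s"
    "t + credit n d s \<le> 11 * (n*d) + 12 * n + 4 * d + 15 + (14 * (n*d) + 5) * d"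
    unfolding wp_def by auto
  have "dom_codes ?f k = grid_codes d (initial_grid D) k" if "k < n*d" for k
    using input_store_dom[OF that] by (simp add: dom_codes_def grid_codes_def initial_grid_def)
  note r = finished_represents[OF s(2) this d root starts_initial]
  show ?case
    by (rule exI[of _ s], rule exI[of _ t], rule exI[of _ "dom_codes ?f"])
      (use s r session.start[OF s(1)] in auto)
next
  case (decide ds A a b A')
  then obtain s t T where s: "session start resume n d D ds s t" "finished n d T s"
    "s ''conflict'' 0 = 0" "A = completion n d (codes_grid d (s ''atom''))"
    "t + credit n d s \<le> 11 * (n*d) + 12 * n + 4 * d + 15 + (14 * (n*d) + 5) * d + 13 * length ds"
    "length ds \<le> card (assigned_cells n d A)" by blast
  let ?a = "s ''atom''"
  \<comment> \<open>\<open>Bot\<close>, \<open>Sat\<close> and \<open>Violate\<close> have values in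
    the completion, so an unassigned atom of the program must be a grid cell.\<close>
  obtain v i where a: "a = E v i" "v \<in> {1..n}" "i \<in> {1..d}"
    using decide.hyps(3,4) unfolding s(4) by (auto elim: atoms_alldiff_program)
  define k where "k = (v - 1) * d + (i - 1)"
  note c = cell_index[OF a(2,3), folded k_def]
  have ak: "?a k = 0"
    using decide.hyps(4) a unfolding s(4) by (simp add: codes_grid_def Let_def k_def split: if_splits)
  define w where "w = write_decision n d (a, b) s"
  have w: "w ''decision'' 0 = k" "w ''decision'' 1 = (if b then 1 else 0)" "w ''atom'' = ?a" "w ''conflict'' = s ''conflict''"
    by (simp_all add: w_def write_decision_def a(1) k_def)
  have fin: "finished n d T w" "credit n d w = credit n d s"
    using s(2) by (simp_all add: w_def write_decision_def finished_def state_inv_def tables_def fixed_values_def credit_def)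
  have "wp resume (\<lambda>s' t'. finished n d (?a(k := if b then 2 else 1)) s' \<and> t' + credit n d s' \<le> 0 + credit n d s + 13) w 0"
    using wp_resume[OF fin(1) _ w(1,2) c(1) _ d, of 0] s(3) ak w(3,4) fin(2) by simp
  then obtain s' t' where s': "exec resume w t' s'" "finished n d (?a(k := if b then 2 else 1)) s'"
    "t' + credit n d s' \<le> credit n d s + 13" unfolding wp_def by auto
  define G where "G = (\<lambda>x y. if x = v \<and> y = i then Some b else codes_grid d ?a x y)"
  have st: "starts n d G (A(Atom a \<mapsto> b))"
  proof -
    \<comment> \<open>Apart from the cells, the completion does not depend on the grid, so a
      decision turns one completion into another.\<close>
    have "A(Atom a \<mapsto> b) = completion n d G"
      unfolding s(4) a(1) using a(2,3)
      by (auto simp: fun_eq_iff completion_def G_def split: entity.splits atom.splits)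
    then show ?thesis by (simp add: starts_def)
  qed
  have le2: "?a l \<le> 2" if "l < n*d" for l
    using s(2) that by (simp add: finished_def state_inv_def prop_inv_def)
  have G: "(?a(k := if b then 2 else 1)) l = grid_codes d G l" if l: "l < n*d" for l
  proof (cases "l = k")
    case True
    have "grid_codes d G k = encode (G v i)" unfolding k_def by (rule grid_codes_cell[OF a(2,3)])
    with True show ?thesis by (cases b) (simp_all add: G_def)
  next
    case False
    note e = index_cell[OF l]
    have "\<not> (l div d + 1 = v \<and> l mod d + 1 = i)" using e(3) False unfolding k_def by metis
    then have "grid_codes d G l = encode (codes_grid d ?a (l div d + 1) (l mod d + 1))"
      by (auto simp: grid_codes_def G_def)
    also have "\<dots> = ?a l"
    proof -
      from le2[OF l] have "?a l = 0 \<or> ?a l = 1 \<or> ?a l = 2" by linarith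
      then show ?thesis using e(3) by (auto simp: codes_grid_def)
    qed
    finally show ?thesis using False by simp
  qed
  note r = finished_represents[OF s'(2) G d decide.hyps(5) st]
  have "A(Atom a \<mapsto> b) \<subseteq>\<^sub>m A'"
    using decide.hyps(5) unfolding up_fixpoint_def by (blast intro: up_steps_map_le)
  then have le: "A' x \<noteq> None" if "(A(Atom a \<mapsto> b)) x \<noteq> None" for x
    using that unfolding map_le_def by (metis domIff)
  have "insert (v, i) (assigned_cells n d A) \<subseteq> assigned_cells n d A'"
    using le a by (auto simp: assigned_cells_def)
  then have "card (insert (v, i) (assigned_cells n d A)) \<le> card (assigned_cells n d A')"
    by (intro card_mono finite_assigned_cells)
  moreover have "(v, i) \<notin> assigned_cells n d A" using decide.hyps(4) a by (simp add: assigned_cells_def)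
  ultimately have len: "length (ds @ [(a, b)]) \<le> card (assigned_cells n d A')"
    using s(6) by (simp add: finite_assigned_cells)
  have "session start resume n d D (ds @ [(a, b)]) s' (t + t')"
    using session.resume[OF s(1)] s'(1) unfolding w_def by blast
  moreover from s'(2) obtain T' where "finished n d T' s'" by blast
  ultimately show ?case
    by (intro exI[of _ s'] exI[of _ "t + t'"] exI[of _ T']) (use s'(3) s(5) r len in auto)
qed

theorem corollary1:
  "(\<forall>n d. up_enforces_ac n d (alldiff_program n d) (neq_decomposition n)) \<and>
   up_total_time alldiff_program (\<lambda>n d. n * d\<^sup>2)"
proof
  show "\<forall>n d. up_enforces_ac n d (alldiff_program n d) (neq_decomposition n)"
    by (intro allI up_enforces_ac_alldiff)
  show "up_total_time alldiff_program (\<lambda>n d. n * d\<^sup>2)"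
    unfolding up_total_time_def
  \<comment> \<open>\<open>74 = 11 + 12 + 4 + 15 + 14 + 5 + 13\<close>, the sum of the coefficients
    in \<open>branch_session\<close>: for positive \<open>n\<close> and \<open>d\<close>, each of
    \<open>n*d\<close>, \<open>n\<close>, \<open>d\<close>, 1 and the number of decisions is at most
    \<open>n * d * d\<close>.\<close>
  proof (rule exI[of _ start], rule exI[of _ resume], rule exI[of _ 74], intro allI impI)
    fix n d :: nat and D ds A
    assume n: "1 \<le> n" and d: "1 \<le> d" and D: "initial_domains n d D"
      and b: "branch (alldiff_program n d) (initial_assignment n d D) ds A"
    from branch_session[OF n d D b] obtain s t where
      s: "session start resume n d D ds s t" "represents n d (alldiff_program n d) s A"
      and t: "t + credit n d s \<le> 11 * (n*d) + 12 * n + 4 * d + 15 + (14 * (n*d) + 5) * d + 13 * length ds"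
      and len: "length ds \<le> card (assigned_cells n d A)" by blast
    have "length ds \<le> n*d" using len card_assigned_cells[of n d A] by linarith
    moreover define M where "M = n * d * d"
    have "n * 1 * 1 \<le> M" "1 * d * 1 \<le> M" "1 * 1 * 1 \<le> M" "n * d * 1 \<le> M"
      unfolding M_def
      by (rule mult_le_mono[OF mult_le_mono[OF le_refl d] d] mult_le_mono[OF mult_le_mono[OF n le_refl] d]
          mult_le_mono[OF mult_le_mono[OF n d] d] mult_le_mono[OF le_refl d])+
    moreover have "(14 * (n*d) + 5) * d = 14 * M + 5 * d" by (simp add: M_def algebra_simps)
    ultimately have "t \<le> 74 * M" using t by linarith
    with s show "\<exists>s t. session start resume n d D ds s t \<and> t \<le> 74 * (n * d\<^sup>2) \<and> represents n d (alldiff_program n d) s A"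
      by (auto simp: M_def power2_eq_square algebra_simps)
  qed
qed

end
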